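(* For any $(\pi_b,\epsilon,e_Q)$-constrained policy $\pi$ that is $\pi_b$-advantageous w.r.t. $\hat{Q}^{\pi_b}_{\mathcal{D}}$, where $\hat{Q}^{\pi_b}_{\mathcal{D}}$ is estimated with independent returns for each state-action pair, the following inequality holds: $$\mathbb{P}_\mathcal{D}\left(\forall s\in\mathcal{S}:\ V_{M^*}^{\pi}(s)-V_{M^*}^{\pi_b}(s)\geq-\frac{\epsilon\, G_{max}}{1-\gamma}\right)\geq 1-\delta,$$ where $M^*$ is the true MDP on which the data $\mathcal{D}$ gets sampled by the baseline policy $\pi_b$, $0\le\gamma<1$ is the discount factor, and $\delta>0$ is the safety parameter for $e_Q$.
   Context: A finite MDP is a tuple $M=(\mathcal{S},\mathcal{A},P,R,\gamma)$ with finite state space $\mathcal{S}$, finite action space $\mathcal{A}$, transition probabilities $P(s'|s,a)$, stochastic reward function $R$ bounded in absolute value, and discount factor $0\le\gamma<1$. A policy $\pi(a|s)$ gives the probability of choosing action $a$ in state $s$. The return at time $t$ is $G_t=\sum_{i=t}^{T}\gamma^{i-t}R(s_i,a_i)$, with $T$ the time of termination, and $G_{max}$ is an upper bound on the absolute value of the return in any state-action pair of any policy. The value functions are $V^\pi_M(s)=E_\pi[G_t\mid S_t=s]$ and $Q^\pi_M(s,a)=E_\pi[G_t\mid S_t=s,A_t=a]$. The data set $\mathcal{D}$ is generated by $\pi_b$ on $M^*$, and the subscript of $\mathbb{P}_\mathcal{D}$ emphasizes that $\mathcal{D}$ is the random quantity. $N_\mathcal{D}(s,a)$ is the number of visits of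 $(s,a)$ in $\mathcal{D}$. The Monte-Carlo estimate of $Q^{\pi_b}_{M^*}(s,a)$ is $$\hat{Q}^{\pi_b}_\mathcal{D}(s,a)=\frac1n\sum_{i=1}^n G_{t_i},$$ where $t_1,\dots,t_n$ are times such that $(S_{t_i},A_{t_i})=(s,a)$ for all $i$, and $E[G_{t_i}]=Q^{\pi_b}_{M^*}(s,a)$. The error function is $$e_Q(s,a)=\sqrt{\frac{2}{N_\mathcal{D}(s,a)}\log\frac{2|\mathcal{S}||\mathcal{A}|}{\delta}}.$$ For an error function $e$ and a hyper-parameter $\epsilon>0$, a policy $\pi$ is $(\pi_b,\epsilon,e)$-constrained if $\sum_{a\in\mathcal{A}} e(s,a)\,|\pi(a|s)-\pi_b(a|s)|\le\epsilon$ for all $s\in\mathcal{S}$. A policy $\pi$ is $\pi_b$-advantageous w.r.t. a function $Q:\mathcal{S}\times\mathcal{A}\to\mathbb{R}$ if $\sum_a Q(s,a)\pi(a|s)\ge\sum_a Q(s,a)\pi_b(a|s)$ for all $s\in\mathcal{S}$. *)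

theory Defs
  imports "HOL-Probability.Probability"
begin

text \<open>
  The state space and the action space are finite types. \<open>terminal\<close> makes the time of termination
  explicit: an episode ends with the step taken in the first terminal state it reaches. It may be
  empty, and then episodes never end.
\<close>

record ('s, 'a) mdp =
  trans :: "'s \<Rightarrow> 'a \<Rightarrow> 's pmf"
  reward :: "'s \<Rightarrow> 'a \<Rightarrow> real measure"
  discount :: real
  terminal :: "'s set"

definition mdp :: "('s::finite, 'a::finite) mdp \<Rightarrow> bool" where
  "mdp M \<longleftrightarrow>
     (\<forall>s a. prob_space (reward M s a) \<and> sets (reward M s a) = sets borel) \<and>
     (\<exists>B. \<forall>s a. AE r in reward M s a. \<bar>r\<bar> \<le> B) \<and>
     0 \<le> discount M \<and> discount M < 1"

type_synonym ('s, 'a) policy = "'s \<Rightarrow> 'a pmf"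
type_synonym ('s, 'a) trajectory = "nat \<Rightarrow> 's \<times> 'a \<times> real"

definition step_space :: "('s \<times> 'a \<times> real) measure" where
  "step_space = count_space UNIV \<Otimes>\<^sub>M (count_space UNIV \<Otimes>\<^sub>M borel)"

definition step_from_sa :: "('s, 'a) mdp \<Rightarrow> 's \<Rightarrow> 'a \<Rightarrow> ('s \<times> 'a \<times> real) measure" where
  "step_from_sa M s a = distr (reward M s a) step_space (\<lambda>r. (s, a, r))"

definition step_from ::
    "('s, 'a) mdp \<Rightarrow> ('s, 'a) policy \<Rightarrow> 's \<Rightarrow> ('s \<times> 'a \<times> real) measure" where
  "step_from M \<pi> s = measure_pmf (\<pi> s) \<bind> step_from_sa M s"

definition step_init ::
    "('s, 'a) mdp \<Rightarrow> ('s, 'a) policy \<Rightarrow> 's pmf \<Rightarrow> ('s \<times> 'a \<times> real) measure" where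
  "step_init M \<pi> \<mu> = measure_pmf \<mu> \<bind> step_from M \<pi>"

definition next_step ::
    "('s, 'a) mdp \<Rightarrow> ('s, 'a) policy \<Rightarrow> 's \<times> 'a \<times> real \<Rightarrow> ('s \<times> 'a \<times> real) measure" where
  "next_step M \<pi> = (\<lambda>(s, a, r). measure_pmf (trans M s a) \<bind> step_from M \<pi>)"

definition traj_kernel ::
    "('s, 'a) mdp \<Rightarrow> ('s, 'a) policy \<Rightarrow> ('s \<times> 'a \<times> real) measure \<Rightarrow>
     nat \<Rightarrow> ('s, 'a) trajectory \<Rightarrow> ('s \<times> 'a \<times> real) measure" where
  "traj_kernel M \<pi> \<nu> n h = (if n = 0 then \<nu> else next_step M \<pi> (h (n - 1)))"

text \<open>
  The law of the process \<open>(S\<^sub>t, A\<^sub>t, R\<^sub>t)\<close> for \<open>t = 0, 1, \<dots>\<close> under the policy \<open>\<pi>\<close>, when its first step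
  has law \<open>\<nu>\<close>; it is the Ionescu-Tulcea measure of the kernels above. The process runs on after
  termination, but what happens then enters neither the returns nor the data.
\<close>

definition traj ::
    "('s, 'a) mdp \<Rightarrow> ('s, 'a) policy \<Rightarrow> ('s \<times> 'a \<times> real) measure \<Rightarrow>
     ('s, 'a) trajectory measure" where
  "traj M \<pi> \<nu> =
     projective_family.lim UNIV
       (Ionescu_Tulcea.CI (traj_kernel M \<pi> \<nu>) (\<lambda>_. step_space)) (\<lambda>_. step_space)"

lemma step_from_sa_prob:
  assumes "mdp M"
  shows "step_from_sa M s a \<in> space (prob_algebra step_space)"
proof -
  interpret prob_space "reward M s a" using assms by (simp add: mdp_def)
  have [measurable_cong]: "sets (reward M s a) = sets borel" using assms by (simp add: mdp_def)
  have "(\<lambda>r. (s, a, r)) \<in> reward M s a \<rightarrow>\<^sub>M step_space"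
    unfolding step_space_def by measurable
  then show ?thesis
    by (simp add: step_from_sa_def space_prob_algebra prob_space_distr)
qed

lemma bind_pmf_prob_algebra:
  assumes "\<And>x. f x \<in> space (prob_algebra N)"
  shows "measure_pmf p \<bind> f \<in> space (prob_algebra N)"
proof -
  have f: "f \<in> measure_pmf p \<rightarrow>\<^sub>M prob_algebra N"
    using assms by (auto simp: measurable_def sets_measure_pmf)
  have p: "measure_pmf p \<in> space (prob_algebra (count_space UNIV))"
    by (auto simp: space_prob_algebra measure_pmf.prob_space_axioms)
  have f': "f \<in> count_space UNIV \<rightarrow>\<^sub>M prob_algebra N"
    using assms by simp
  show ?thesis
    using sets_bind'[OF p f'] prob_space_bind'[OF p f'] by (simp add: space_prob_algebra)
qed

lemma step_from_prob: "mdp M \<Longrightarrow> step_from M \<pi> s \<in> space (prob_algebra step_space)"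
  unfolding step_from_def by (intro bind_pmf_prob_algebra step_from_sa_prob)

lemma step_init_prob: "mdp M \<Longrightarrow> step_init M \<pi> \<mu> \<in> space (prob_algebra step_space)"
  unfolding step_init_def by (intro bind_pmf_prob_algebra step_from_prob)

lemma next_step_prob: "mdp M \<Longrightarrow> next_step M \<pi> x \<in> space (prob_algebra step_space)"
  unfolding next_step_def by (auto split: prod.split intro!: bind_pmf_prob_algebra step_from_prob)

lemma next_step_measurable:
  fixes M :: "('s::finite, 'a::finite) mdp"
  assumes "mdp M"
  shows "next_step M \<pi> \<in> step_space \<rightarrow>\<^sub>M prob_algebra step_space"
proof -
  have *: "(\<lambda>(s, a). measure_pmf (trans M s a) \<bind> step_from M \<pi>) \<in>
      count_space UNIV \<rightarrow>\<^sub>M prob_algebra step_space"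
    using assms by (auto intro!: bind_pmf_prob_algebra step_from_prob)
  have "(\<lambda>x. (fst x, fst (snd x))) \<in> (step_space :: ('s \<times> 'a \<times> real) measure)
      \<rightarrow>\<^sub>M count_space UNIV \<Otimes>\<^sub>M count_space UNIV"
    unfolding step_space_def by measurable
  then have "(\<lambda>x. (fst x, fst (snd x))) \<in> (step_space :: ('s \<times> 'a \<times> real) measure) \<rightarrow>\<^sub>M count_space UNIV"
    by (simp add: pair_measure_countable)
  from measurable_compose[OF this *] show ?thesis
    by (simp add: next_step_def case_prod_unfold)
qed

lemma Ionescu_Tulcea_traj_kernel:
  fixes M :: "('s::finite, 'a::finite) mdp"
  assumes M: "mdp M" and \<nu>: "\<nu> \<in> space (prob_algebra step_space)"
  shows "Ionescu_Tulcea (traj_kernel M \<pi> \<nu>) (\<lambda>_. step_space)"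
proof (rule Ionescu_Tulcea.intro)
  fix i
  show "traj_kernel M \<pi> \<nu> i \<in> Pi\<^sub>M {0..<i} (\<lambda>_. step_space) \<rightarrow>\<^sub>M subprob_algebra step_space"
  proof (cases "i = 0")
    case True
    have "(\<lambda>_. \<nu>) \<in> Pi\<^sub>M {0..<i} (\<lambda>_. step_space) \<rightarrow>\<^sub>M subprob_algebra step_space"
      by (rule measurable_prob_algebraD) (use \<nu> in simp)
    with True show ?thesis by (simp add: traj_kernel_def[abs_def])
  next
    case False
    then have "(\<lambda>h. h (i - 1)) \<in> Pi\<^sub>M {0..<i} (\<lambda>_. step_space) \<rightarrow>\<^sub>M step_space"
      by (intro measurable_component_singleton) auto
    from measurable_compose[OF this measurable_prob_algebraD[OF next_step_measurable[OF M]]]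
    show ?thesis using False by (simp add: traj_kernel_def[abs_def])
  qed
next
  fix i and x :: "('s, 'a) trajectory"
  assume "x \<in> space (Pi\<^sub>M {0..<i} (\<lambda>_. step_space))"
  show "prob_space (traj_kernel M \<pi> \<nu> i x)"
    using \<nu> next_step_prob[OF M] by (auto simp: traj_kernel_def space_prob_algebra)
qed

lemma prob_space_traj:
  fixes M :: "('s::finite, 'a::finite) mdp"
  assumes "mdp M" "\<nu> \<in> space (prob_algebra step_space)"
  shows "prob_space (traj M \<pi> \<nu>)"
    and "sets (traj M \<pi> \<nu>) = sets (Pi\<^sub>M UNIV (\<lambda>_. step_space))"
proof -
  interpret Ionescu_Tulcea "traj_kernel M \<pi> \<nu>" "\<lambda>_. step_space"
    using assms by (rule Ionescu_Tulcea_traj_kernel)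
  show "sets (traj M \<pi> \<nu>) = sets (Pi\<^sub>M UNIV (\<lambda>_. step_space))"
    unfolding traj_def by (rule PF.sets_lim)
  interpret CI: prob_space "CI {}"
    by (intro PF.prob_space_P) auto
  have "emeasure PF.lim (PF.emb UNIV {} {\<lambda>x. undefined}) = 1"
    using CI.emeasure_space_1 by (subst lim) (auto simp: space_PiM sets_PiM_empty CI_def)
  then show "prob_space (traj M \<pi> \<nu>)"
    unfolding traj_def by (intro prob_spaceI) (simp add: prod_emb_def space_PiM restrict_def vimage_def)
qed

definition termination_time :: "('s, 'a) mdp \<Rightarrow> ('s, 'a) trajectory \<Rightarrow> enat" where
  "termination_time M \<omega> = (INF i\<in>{i. fst (\<omega> i) \<in> terminal M}. enat i)"

definition ret :: "('s, 'a) mdp \<Rightarrow> nat \<Rightarrow> ('s, 'a) trajectory \<Rightarrow> real" where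
  "ret M t \<omega> =
     (\<Sum>i. if t \<le> i \<and> enat i \<le> termination_time M \<omega>
          then discount M ^ (i - t) * snd (snd (\<omega> i)) else 0)"

lemma ret_measurable:
  "ret M t \<in> borel_measurable (Pi\<^sub>M UNIV (\<lambda>_. step_space :: ('s::finite \<times> 'a::finite \<times> real) measure))"
proof -
  have [measurable]: "(\<lambda>\<omega>. snd (snd (\<omega> i))) \<in> borel_measurable (Pi\<^sub>M UNIV (\<lambda>_. step_space :: ('s \<times> 'a \<times> real) measure))"
     "(\<lambda>\<omega>. fst (\<omega> i)) \<in> (Pi\<^sub>M UNIV (\<lambda>_. step_space :: ('s \<times> 'a \<times> real) measure)) \<rightarrow>\<^sub>M count_space UNIV" for i
    unfolding step_space_def by measurable
  have "(enat i \<le> termination_time M \<omega>) \<longleftrightarrow> (\<forall>j<i. fst (\<omega> j) \<notin> terminal M)" for i \<omega>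
    by (force simp: termination_time_def le_INF_iff not_le[symmetric])
  then show ?thesis unfolding ret_def[abs_def] by simp
qed

definition V :: "('s, 'a) mdp \<Rightarrow> ('s, 'a) policy \<Rightarrow> 's \<Rightarrow> real" where
  "V M \<pi> s = (\<integral>\<omega>. ret M 0 \<omega> \<partial>traj M \<pi> (step_from M \<pi> s))"

definition Q :: "('s, 'a) mdp \<Rightarrow> ('s, 'a) policy \<Rightarrow> 's \<Rightarrow> 'a \<Rightarrow> real" where
  "Q M \<pi> s a = (\<integral>\<omega>. ret M 0 \<omega> \<partial>traj M \<pi> (step_from_sa M s a))"

definition return_bound :: "('s, 'a) mdp \<Rightarrow> real \<Rightarrow> bool" where
  "return_bound M Gmax \<longleftrightarrow>
     (\<forall>\<pi> s a. AE \<omega> in traj M \<pi> (step_from_sa M s a). \<bar>ret M 0 \<omega>\<bar> \<le> Gmax)"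

text \<open>
  The data: \<open>K\<close> independent episodes of \<open>\<pi>\<^sub>b\<close> with initial distribution \<open>\<mu>\<close>, where \<open>D k\<close> is the
  \<open>k\<close>-th episode. \<open>rec D\<close> is the finite set of steps \<open>(k, t)\<close> (time \<open>t\<close> of episode \<open>k\<close>) that the data
  set contains: for instance all steps up to termination, or only those at which a state-action
  pair occurs for the first time in its episode, as needed for independent returns.
\<close>

type_synonym ('s, 'a) data = "nat \<Rightarrow> ('s, 'a) trajectory"

definition data_measure ::
    "('s, 'a) mdp \<Rightarrow> ('s, 'a) policy \<Rightarrow> 's pmf \<Rightarrow> nat \<Rightarrow> ('s, 'a) data measure" where
  "data_measure M \<pi>\<^sub>b \<mu> K = Pi\<^sub>M {..<K} (\<lambda>_. traj M \<pi>\<^sub>b (step_init M \<pi>\<^sub>b \<mu>))"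

definition recording ::
    "('s, 'a) mdp \<Rightarrow> ('s, 'a) policy \<Rightarrow> 's pmf \<Rightarrow> nat \<Rightarrow>
     (('s, 'a) data \<Rightarrow> (nat \<times> nat) set) \<Rightarrow> bool" where
  "recording M \<pi>\<^sub>b \<mu> K rec \<longleftrightarrow>
     rec \<in> data_measure M \<pi>\<^sub>b \<mu> K \<rightarrow>\<^sub>M count_space {U. finite U} \<and>
     (\<forall>D\<in>space (data_measure M \<pi>\<^sub>b \<mu> K). \<forall>(k, t)\<in>rec D.
        k < K \<and> enat t \<le> termination_time M (D k))"

definition visits ::
    "(('s, 'a) data \<Rightarrow> (nat \<times> nat) set) \<Rightarrow> ('s, 'a) data \<Rightarrow> 's \<Rightarrow> 'a \<Rightarrow> (nat \<times> nat) set" where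
  "visits rec D s a = {(k, t) \<in> rec D. fst (D k t) = s \<and> fst (snd (D k t)) = a}"

definition N_visits ::
    "(('s, 'a) data \<Rightarrow> (nat \<times> nat) set) \<Rightarrow> ('s, 'a) data \<Rightarrow> 's \<Rightarrow> 'a \<Rightarrow> nat" where
  "N_visits rec D s a = card (visits rec D s a)"

definition Q_hat ::
    "('s, 'a) mdp \<Rightarrow> (('s, 'a) data \<Rightarrow> (nat \<times> nat) set) \<Rightarrow> ('s, 'a) data \<Rightarrow> 's \<Rightarrow> 'a \<Rightarrow> real" where
  "Q_hat M rec D s a =
     (\<Sum>(k, t)\<in>visits rec D s a. ret M t (D k)) / real (N_visits rec D s a)"

text \<open>
  The number and the times \<open>t\<^sub>1, \<dots>, t\<^sub>n\<close> of the visits of \<open>(s, a)\<close> are random. That the returns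
  \<open>G\<^bsub>t\<^sub>i\<^esub>\<close> are independent with mean \<open>Q(s, a)\<close> therefore refers to the conditional probability given
  that \<open>(s, a)\<close> is visited exactly at the times in \<open>U\<close>.
\<close>

definition independent_returns ::
    "('s, 'a) mdp \<Rightarrow> ('s, 'a) policy \<Rightarrow> 's pmf \<Rightarrow> nat \<Rightarrow>
     (('s, 'a) data \<Rightarrow> (nat \<times> nat) set) \<Rightarrow> bool" where
  "independent_returns M \<pi>\<^sub>b \<mu> K rec \<longleftrightarrow>
     (\<forall>s a U. \<P>(D in data_measure M \<pi>\<^sub>b \<mu> K. visits rec D s a = U) > 0 \<longrightarrow>
        (let C = uniform_measure (data_measure M \<pi>\<^sub>b \<mu> K)
                   {D \<in> space (data_measure M \<pi>\<^sub>b \<mu> K). visits rec D s a = U}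
         in prob_space.indep_vars C (\<lambda>_. borel) (\<lambda>(k, t) D. ret M t (D k)) U \<and>
            (\<forall>(k, t)\<in>U. (\<integral>D. ret M t (D k) \<partial>C) = Q M \<pi>\<^sub>b s a)))"

text \<open>
  An unvisited pair has error \<open>2/0 = \<infinity>\<close>, and \<open>\<infinity> * 0 = 0\<close> in \<open>ereal\<close>: a constrained policy agrees with
  \<open>\<pi>\<^sub>b\<close> there.
\<close>

definition e_Q ::
    "(('s::finite, 'a::finite) data \<Rightarrow> (nat \<times> nat) set) \<Rightarrow> real \<Rightarrow> ('s, 'a) data \<Rightarrow>
     's \<Rightarrow> 'a \<Rightarrow> ereal" where
  "e_Q rec \<delta> D s a =
     (if N_visits rec D s a = 0 then \<infinity>
      else ereal (sqrt (2 / real (N_visits rec D s a) *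
             ln (2 * real CARD('s) * real CARD('a) / \<delta>))))"

definition constrained ::
    "('s, 'a::finite) policy \<Rightarrow> real \<Rightarrow> ('s \<Rightarrow> 'a \<Rightarrow> ereal) \<Rightarrow> ('s, 'a) policy \<Rightarrow> bool" where
  "constrained \<pi>\<^sub>b \<epsilon> e \<pi> \<longleftrightarrow>
     (\<forall>s. (\<Sum>a\<in>UNIV. e s a * ereal \<bar>pmf (\<pi> s) a - pmf (\<pi>\<^sub>b s) a\<bar>) \<le> ereal \<epsilon>)"

definition advantageous ::
    "('s, 'a::finite) policy \<Rightarrow> ('s \<Rightarrow> 'a \<Rightarrow> real) \<Rightarrow> ('s, 'a) policy \<Rightarrow> bool" where
  "advantageous \<pi>\<^sub>b q \<pi> \<longleftrightarrow>
     (\<forall>s. (\<Sum>a\<in>UNIV. q s a * pmf (\<pi> s) a) \<ge> (\<Sum>a\<in>UNIV. q s a * pmf (\<pi>\<^sub>b s) a))"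

end

theory Submission
  imports Defs
begin

text \<open>
  With probability at least \<open>1 - \<delta>\<close>, all visited pairs satisfy \<open>\<bar>Q_hat - Q\<bar> \<le> Gmax * e_Q\<close>: conditionally on
  the set of visits, the returns are independent with mean \<open>Q\<close> and bounded by \<open>Gmax\<close>, so Hoeffding's
  inequality bounds the failure probability for each pair by \<open>\<delta> / (|S| |A|)\<close>. On this event, splitting
  \<open>Q\<close> into \<open>Q_hat\<close> and the estimation error shows that the advantage \<open>\<Sum>a. Q s a * (\<pi> - \<pi>\<^sub>b)\<close> is at least
  \<open>- \<epsilon> * Gmax\<close> in every state. At a state minimising \<open>V M \<pi> - V M \<pi>\<^sub>b\<close>, the Bellman equations turn
  this into the bound on the values. They follow from the law of the shifted trajectory, which is
  read off from the probabilities of cylinder sets.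
\<close>

section \<open>The law of trajectories\<close>

text \<open>The policy is a function of the data, so the probabilistic part has to be uniform over
  policies: the bad events speak only of the estimates at the finitely many pairs, and off these
  events the argument is deterministic, for whatever policy the data produce. The bound obtained by
  conditioning is the same for every visit set, so it survives averaging over the countably many
  possible ones. Two gaps separate the hypotheses from this plan. \<open>return_bound\<close>
  concerns the return from time 0 of a process started in a fixed pair, whereas the data contain
  returns from time t of an episode started from \<open>\<mu>\<close>; a Markov property of the
  Ionescu-Tulcea measure has to relate them. And \<open>measure\<close> is 0 outside the
  sigma-algebra, so the final event must be shown measurable although it involves the values of a
  data-dependent policy.\<close>

lemma space_step_space [simp]: "space step_space = UNIV"
  by (simp add: step_space_def space_pair_measure)

lemma space_paths [simp]: "space (Pi\<^sub>M UNIV (\<lambda>_. step_space)) = UNIV"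
  by (simp add: space_PiM PiE_def)

lemma prob_algebra_spaceD:
  assumes "\<nu> \<in> space (prob_algebra N)"
  shows "prob_space \<nu>" "sets \<nu> = sets N" "space \<nu> = space N"
  using assms sets_eq_imp_space_eq by (auto simp: space_prob_algebra)

lemma measurable_pmf_kernel:
  assumes "\<And>x. f x \<in> space (prob_algebra N)"
  shows "f \<in> measure_pmf p \<rightarrow>\<^sub>M subprob_algebra N"
  using assms by (intro measurable_prob_algebraD) (simp add: measurable_def)

text \<open>
  \<open>path_weight M \<pi> n A f x\<close> is the expectation of \<open>f\<close> at step \<open>n\<close> on the event that the steps
  \<open>0, \<dots>, n\<close> lie in \<open>A 0, \<dots>, A n\<close>, for a process whose step \<open>0\<close> is \<open>x\<close>. The recursion unfolds the first step,
  whereas the Ionescu-Tulcea construction appends the last one.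
\<close>

primrec path_weight ::
    "('s, 'a) mdp \<Rightarrow> ('s, 'a) policy \<Rightarrow> nat \<Rightarrow> (nat \<Rightarrow> ('s \<times> 'a \<times> real) set) \<Rightarrow>
     ('s \<times> 'a \<times> real \<Rightarrow> ennreal) \<Rightarrow> 's \<times> 'a \<times> real \<Rightarrow> ennreal" where
  "path_weight M \<pi> 0 A f x = indicator (A 0) x * f x"
| "path_weight M \<pi> (Suc n) A f x =
     indicator (A 0) x * (\<integral>\<^sup>+y. path_weight M \<pi> n (\<lambda>i. A (Suc i)) f y \<partial>next_step M \<pi> x)"

text \<open>The bridge between the two recursions: integrating out a last step inside the end
  function gives the same as unfolding one more first step. The induction in
  \<open>emeasure_traj_cylinder\<close>, where only the last kernel is accessible, closes through
  it.\<close>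

lemma path_weight_last:
  "path_weight M \<pi> n A (\<lambda>x. \<integral>\<^sup>+y. indicator (A (Suc n)) y * f y \<partial>next_step M \<pi> x) x =
     path_weight M \<pi> (Suc n) A f x"
proof (induction n arbitrary: A x)
  case (Suc n)
  show ?case
    using Suc.IH[of "\<lambda>i. A (Suc i)"] by simp
qed simp

lemma measurable_path_weight:
  fixes M :: "('s::finite, 'a::finite) mdp"
  assumes M: "mdp M" and f: "f \<in> borel_measurable step_space" and A: "\<And>i. A i \<in> sets step_space"
  shows "path_weight M \<pi> n A f \<in> borel_measurable step_space"
  using A
proof (induction n arbitrary: A)
  case 0
  note [measurable] = 0 f
  show ?case by simp
next
  case (Suc n)
  note [measurable] = Suc.prems
  have "(\<lambda>x. \<integral>\<^sup>+y. path_weight M \<pi> n (\<lambda>i. A (Suc i)) f y \<partial>next_step M \<pi> x) \<in> borel_measurable step_space"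
    by (intro measurable_compose[OF measurable_prob_algebraD[OF next_step_measurable[OF M]]
          nn_integral_measurable_subprob_algebra] Suc)
  then show ?case by simp
qed

lemma emeasure_traj_cylinder:
  fixes M :: "('s::finite, 'a::finite) mdp"
  assumes M: "mdp M" and \<nu>: "\<nu> \<in> space (prob_algebra step_space)"
    and A: "\<And>i. A i \<in> sets step_space"
  shows "emeasure (traj M \<pi> \<nu>) {\<omega>. \<forall>i\<le>n. \<omega> i \<in> A i} = (\<integral>\<^sup>+x. path_weight M \<pi> n A (\<lambda>_. 1) x \<partial>\<nu>)"
proof -
  interpret IT: Ionescu_Tulcea "traj_kernel M \<pi> \<nu>" "\<lambda>_. step_space"
    using M \<nu> by (rule Ionescu_Tulcea_traj_kernel)
  note [measurable] = A
  have u: "(\<lambda>_. undefined) \<in> space (Pi\<^sub>M {0..<0} (\<lambda>_. step_space :: ('s \<times> 'a \<times> real) measure))"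
    by (simp add: space_PiM PiE_def extensional_def)
  \<comment> \<open>The end function \<open>f\<close> is the generalisation that carries the
    induction: the kernel of the last step is absorbed into a new end function \<open>?g\<close> one
    step earlier. The history before time 0 is the empty one, represented by the constant
    \<open>undefined\<close>.\<close>
  have integral_C: "(\<integral>\<^sup>+\<omega>. (\<Prod>i\<le>n. indicator (A i) (\<omega> i)) * f (\<omega> n) \<partial>IT.C 0 (Suc n) (\<lambda>_. undefined)) =
      (\<integral>\<^sup>+x. path_weight M \<pi> n A f x \<partial>\<nu>)" if "f \<in> borel_measurable step_space" for n f
    using that
  proof (induction n arbitrary: f)
    case 0
    note [measurable] = 0
    have "(\<lambda>x. x 0) \<in> Pi\<^sub>M {0..<Suc 0} (\<lambda>_. step_space) \<rightarrow>\<^sub>M (step_space :: ('s \<times> 'a \<times> real) measure)"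
      by (intro measurable_component_singleton) auto
    note [measurable] = this
    have k: "traj_kernel M \<pi> \<nu> 0 h = \<nu>" for h
      by (simp add: traj_kernel_def)
    have C: "IT.C 0 (Suc 0) (\<lambda>_. undefined) = IT.eP 0 (\<lambda>_. undefined)"
      using bind_return[OF IT.measurable_eP u] by simp
    have "path_weight M \<pi> 0 A f = (\<lambda>x. indicator (A 0) x * f x)"
      by (rule ext) simp
    then show ?case
      unfolding C by (subst IT.nn_integral_eP[OF u]) (simp_all add: k)
  next
    case (Suc n)
    note [measurable] = Suc.prems
    have comp [measurable]: "(\<lambda>x. x i) \<in> Pi\<^sub>M {0..<Suc (Suc n)} (\<lambda>_. step_space) \<rightarrow>\<^sub>M (step_space :: ('s \<times> 'a \<times> real) measure)"
      if "i \<le> Suc n" for i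
      using that by (intro measurable_component_singleton) auto
    let ?g = "\<lambda>x. \<integral>\<^sup>+y. indicator (A (Suc n)) y * f y \<partial>next_step M \<pi> x"
    have g: "?g \<in> borel_measurable step_space"
      by (intro measurable_compose[OF measurable_prob_algebraD[OF next_step_measurable[OF M]]
          nn_integral_measurable_subprob_algebra]) simp
    have m: "(\<lambda>\<omega>. (\<Prod>i\<le>Suc n. indicator (A i) (\<omega> i)) * f (\<omega> (Suc n)))
        \<in> borel_measurable (Pi\<^sub>M {0..<Suc (Suc n)} (\<lambda>_. step_space))"
      by (intro borel_measurable_times_ennreal borel_measurable_prod_ennreal
          measurable_compose[OF comp borel_measurable_indicator] measurable_compose[OF comp Suc.prems]) auto
    have "(\<integral>\<^sup>+\<omega>. (\<Prod>i\<le>Suc n. indicator (A i) (\<omega> i)) * f (\<omega> (Suc n)) \<partial>IT.C 0 (Suc (Suc n)) (\<lambda>_. undefined)) =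
      (\<integral>\<^sup>+\<omega>. \<integral>\<^sup>+\<omega>'. (\<Prod>i\<le>Suc n. indicator (A i) (\<omega>' i)) * f (\<omega>' (Suc n)) \<partial>IT.eP (Suc n) \<omega> \<partial>IT.C 0 (Suc n) (\<lambda>_. undefined))"
      unfolding IT.C.simps(2)[of 0 "Suc n"] add_0
      by (rule nn_integral_bind[OF m])
         (use IT.measurable_eP IT.sets_C[OF u, of "Suc n"] in \<open>simp cong: measurable_cong_sets\<close>)
    also have "\<dots> = (\<integral>\<^sup>+\<omega>. (\<Prod>i\<le>n. indicator (A i) (\<omega> i)) * ?g (\<omega> n) \<partial>IT.C 0 (Suc n) (\<lambda>_. undefined))"
    proof (rule nn_integral_cong)
      fix \<omega> assume "\<omega> \<in> space (IT.C 0 (Suc n) (\<lambda>_. undefined))"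
      then have w: "\<omega> \<in> space (Pi\<^sub>M {0..<Suc n} (\<lambda>_. step_space))"
        using IT.space_C[OF u, of "Suc n"] by simp
      have "(\<integral>\<^sup>+\<omega>'. (\<Prod>i\<le>Suc n. indicator (A i) (\<omega>' i)) * f (\<omega>' (Suc n)) \<partial>IT.eP (Suc n) \<omega>) =
         (\<integral>\<^sup>+y. (\<Prod>i\<le>Suc n. indicator (A i) ((fun_upd \<omega> (Suc n) y) i)) * f ((fun_upd \<omega> (Suc n) y) (Suc n)) \<partial>next_step M \<pi> (\<omega> n))"
        by (subst IT.nn_integral_eP[OF w m]) (simp add: traj_kernel_def)
      also have "\<dots> = (\<integral>\<^sup>+y. (\<Prod>i\<le>n. indicator (A i) (\<omega> i)) * (indicator (A (Suc n)) y * f y) \<partial>next_step M \<pi> (\<omega> n))"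
        by (intro nn_integral_cong) (simp add: mult_ac)
      also have "\<dots> = (\<Prod>i\<le>n. indicator (A i) (\<omega> i)) * ?g (\<omega> n)"
        using prob_algebra_spaceD(2)[OF next_step_prob[OF M, of \<pi> "\<omega> n"]]
        by (intro nn_integral_cmult) (simp cong: measurable_cong_sets)
      finally show "(\<integral>\<^sup>+\<omega>'. (\<Prod>i\<le>Suc n. indicator (A i) (\<omega>' i)) * f (\<omega>' (Suc n)) \<partial>IT.eP (Suc n) \<omega>) =
        (\<Prod>i\<le>n. indicator (A i) (\<omega> i)) * ?g (\<omega> n)" .
    qed
    also have "\<dots> = (\<integral>\<^sup>+x. path_weight M \<pi> (Suc n) A f x \<partial>\<nu>)"
      unfolding Suc.IH[OF g] path_weight_last ..
    finally show ?case .
  qed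
  \<comment> \<open>The event is the preimage of a finite-dimensional rectangle, so the projective
    limit evaluates it by its marginal on the first n + 1 steps.\<close>
  let ?J = "{0..<Suc n}" and ?X = "Pi\<^sub>E {0..<Suc n} A"
  have X: "?X \<in> sets (Pi\<^sub>M ?J (\<lambda>_. step_space))"
    by (intro sets_PiM_I_finite) auto
  have "{\<omega>. \<forall>i\<le>n. \<omega> i \<in> A i} = prod_emb UNIV (\<lambda>_. step_space) ?J ?X"
    by (auto simp: prod_emb_def PiE_iff)
  then have "emeasure (traj M \<pi> \<nu>) {\<omega>. \<forall>i\<le>n. \<omega> i \<in> A i} = emeasure (IT.CI ?J) ?X"
    unfolding traj_def using X by (simp only: IT.lim finite_atLeastLessThan)
  also have "\<dots> = emeasure (IT.C 0 (Suc n) (\<lambda>_. undefined)) ?X"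
    using X sets.sets_into_space[OF X]
    by (subst IT.emeasure_CI[of _ "Suc n"]) (simp_all add: prod_emb_id space_PiM del: IT.C.simps)
  also have "\<dots> = (\<integral>\<^sup>+\<omega>. indicator ?X \<omega> \<partial>IT.C 0 (Suc n) (\<lambda>_. undefined))"
    using X IT.sets_C[OF u, of "Suc n"] by (intro nn_integral_indicator[symmetric]) simp
  also have "\<dots> = (\<integral>\<^sup>+\<omega>. (\<Prod>i\<le>n. indicator (A i) (\<omega> i)) * 1 \<partial>IT.C 0 (Suc n) (\<lambda>_. undefined))"
  proof (rule nn_integral_cong)
    fix \<omega> assume "\<omega> \<in> space (IT.C 0 (Suc n) (\<lambda>_. undefined))"
    then have w: "\<omega> \<in> extensional ?J"
      using IT.space_C[OF u, of "Suc n"] by (simp add: space_PiM PiE_def)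
    show "indicator ?X \<omega> = (\<Prod>i\<le>n. indicator (A i) (\<omega> i)) * (1::ennreal)"
    proof (cases "\<forall>i\<le>n. \<omega> i \<in> A i")
      case True
      with w show ?thesis by (simp add: PiE_iff)
    next
      case False
      then obtain i where "i \<le> n" "\<omega> i \<notin> A i" by auto
      then show ?thesis by (auto simp: PiE_iff prod_zero_iff indicator_def)
    qed
  qed
  also have "\<dots> = (\<integral>\<^sup>+x. path_weight M \<pi> n A (\<lambda>_. 1) x \<partial>\<nu>)"
    by (rule integral_C) simp
  finally show ?thesis .
qed

section \<open>Laws determined by cylinder sets: shifts and mixtures\<close>

lemma traj_eqI:
  fixes M :: "('s::finite, 'a::finite) mdp"
  assumes M: "mdp M" and \<nu>: "\<nu> \<in> space (prob_algebra step_space)"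
    and P: "prob_space P" and sets_P: "sets P = sets (Pi\<^sub>M UNIV (\<lambda>_. step_space))"
    and eq: "\<And>n A. (\<And>i. A i \<in> sets step_space) \<Longrightarrow>
      emeasure P {\<omega>. \<forall>i\<le>n. \<omega> i \<in> A i} = (\<integral>\<^sup>+x. path_weight M \<pi> n A (\<lambda>_. 1) x \<partial>\<nu>)"
  shows "P = traj M \<pi> \<nu>"
proof (rule measure_eqI_PiM_infinite[OF sets_P prob_space_traj(2)[OF M \<nu>]])
  show "finite_measure P" using P by (simp add: prob_space_def)
next
  fix A :: "nat \<Rightarrow> ('s \<times> 'a \<times> real) set" and J
  assume J: "finite J" and A: "\<And>i. i \<in> J \<Longrightarrow> A i \<in> sets step_space"
  \<comment> \<open>Padding with \<open>UNIV\<close> turns a rectangle over an arbitrary finite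
    \<open>J\<close> into a cylinder over an initial segment. For empty \<open>J\<close> the value
    of \<open>Max J\<close> is unspecified, but then every \<open>A' i\<close> is
    \<open>UNIV\<close>.\<close>
  define A' where "A' i = (if i \<in> J then A i else UNIV)" for i
  have A': "A' i \<in> sets step_space" for i
    using A sets.top[of "step_space :: ('s \<times> 'a \<times> real) measure"] by (simp add: A'_def)
  have "prod_emb UNIV (\<lambda>_. step_space) J (Pi\<^sub>E J A) = {\<omega>. \<forall>i\<le>Max J. \<omega> i \<in> A' i}"
    using J by (auto simp: prod_emb_def PiE_iff A'_def)
  then show "emeasure P (prod_emb UNIV (\<lambda>_. step_space) J (Pi\<^sub>E J A)) =
      emeasure (traj M \<pi> \<nu>) (prod_emb UNIV (\<lambda>_. step_space) J (Pi\<^sub>E J A))"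
    using eq[OF A'] emeasure_traj_cylinder[OF M \<nu> A'] by simp
qed

lemma cylinder_sets:
  fixes A :: "nat \<Rightarrow> ('a \<times> 'b \<times> real) set"
  assumes "\<And>i. A i \<in> sets step_space"
  shows "{\<omega>. \<forall>i\<le>n. \<omega> i \<in> A i} \<in> sets (Pi\<^sub>M UNIV (\<lambda>_. step_space))"
proof -
  note [measurable] = assms
  have [measurable]: "(\<lambda>\<omega>. \<omega> i) \<in> Pi\<^sub>M UNIV (\<lambda>_. step_space) \<rightarrow>\<^sub>M (step_space :: ('a \<times> 'b \<times> real) measure)" for i :: nat
    by (rule measurable_component_singleton) simp
  have "{\<omega> \<in> space (Pi\<^sub>M UNIV (\<lambda>_. step_space)). \<forall>i\<le>n. \<omega> i \<in> A i} \<in> sets (Pi\<^sub>M UNIV (\<lambda>_. step_space))"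
    by measurable
  then show ?thesis by simp
qed

lemma traj_prob_algebra:
  fixes M :: "('s::finite, 'a::finite) mdp"
  assumes "mdp M" "\<nu> \<in> space (prob_algebra step_space)"
  shows "traj M \<pi> \<nu> \<in> space (prob_algebra (Pi\<^sub>M UNIV (\<lambda>_. step_space)))"
  using prob_space_traj[OF assms] by (simp add: space_prob_algebra)

lemma bind_next_step_prob:
  fixes M :: "('s::finite, 'a::finite) mdp"
  assumes "mdp M" "\<nu> \<in> space (prob_algebra step_space)"
  shows "\<nu> \<bind> next_step M \<pi> \<in> space (prob_algebra step_space)"
  using sets_bind'[OF assms(2) next_step_measurable[OF assms(1)]]
    prob_space_bind'[OF assms(2) next_step_measurable[OF assms(1)]]
  by (simp add: space_prob_algebra)

lemma measurable_next_step:
  fixes M :: "('s::finite, 'a::finite) mdp"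
  assumes "mdp M" "sets \<nu> = sets step_space"
  shows "next_step M \<pi> \<in> \<nu> \<rightarrow>\<^sub>M subprob_algebra step_space"
  using measurable_prob_algebraD[OF next_step_measurable[OF assms(1)]] assms(2)
  by (simp cong: measurable_cong_sets)

lemma measurable_shift:
  "(\<lambda>\<omega> i. \<omega> (t + i)) \<in> Pi\<^sub>M UNIV (\<lambda>_. N) \<rightarrow>\<^sub>M Pi\<^sub>M UNIV (\<lambda>_. N)" for t :: nat
  by (intro measurable_PiM_single' measurable_component_singleton) (auto simp: space_PiM PiE_iff)

text \<open>The Markov property in the form used below. After time 0 the kernels depend only on the
  previous step and not on the time, so forgetting step 0 leaves a process of the same kind with an
  advanced initial law.\<close>

lemma traj_shift:
  fixes M :: "('s::finite, 'a::finite) mdp"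
  assumes M: "mdp M" and \<nu>: "\<nu> \<in> space (prob_algebra step_space)"
  shows "distr (traj M \<pi> \<nu>) (Pi\<^sub>M UNIV (\<lambda>_. step_space)) (\<lambda>\<omega> i. \<omega> (Suc i)) =
    traj M \<pi> (\<nu> \<bind> next_step M \<pi>)"
proof (rule traj_eqI[OF M bind_next_step_prob[OF M \<nu>]])
  note T = prob_space_traj[OF M \<nu>, of \<pi>]
  have m: "(\<lambda>\<omega> i. \<omega> (Suc i)) \<in> traj M \<pi> \<nu> \<rightarrow>\<^sub>M Pi\<^sub>M UNIV (\<lambda>_. step_space)"
    using measurable_shift[of 1 step_space] T(2) by (simp cong: measurable_cong_sets)
  show "prob_space (distr (traj M \<pi> \<nu>) (Pi\<^sub>M UNIV (\<lambda>_. step_space)) (\<lambda>\<omega> i. \<omega> (Suc i)))"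
    by (rule prob_space.prob_space_distr[OF T(1) m])
  fix n and A :: "nat \<Rightarrow> ('s \<times> 'a \<times> real) set" assume A: "\<And>i. A i \<in> sets step_space"
  \<comment> \<open>A leading \<open>UNIV\<close> leaves step 0 free; the \<open>Suc\<close>
    equation of \<open>path_weight\<close> then strips it off.\<close>
  define A' where "A' i = (case i of 0 \<Rightarrow> UNIV | Suc j \<Rightarrow> A j)" for i
  have A': "A' i \<in> sets step_space" for i
    using A sets.top[of "step_space :: ('s \<times> 'a \<times> real) measure"] by (simp add: A'_def split: nat.split)
  have "emeasure (distr (traj M \<pi> \<nu>) (Pi\<^sub>M UNIV (\<lambda>_. step_space)) (\<lambda>\<omega> i. \<omega> (Suc i))) {\<omega>. \<forall>i\<le>n. \<omega> i \<in> A i} =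
     emeasure (traj M \<pi> \<nu>) {\<omega>. \<forall>i\<le>Suc n. \<omega> i \<in> A' i}"
    using T(2) sets_eq_imp_space_eq[OF T(2)]
    by (subst emeasure_distr[OF m cylinder_sets[OF A]])
       (auto intro!: arg_cong[where f="emeasure _"] simp: A'_def All_less_Suc2 less_Suc_eq_le[symmetric])
  also have "\<dots> = (\<integral>\<^sup>+x. \<integral>\<^sup>+y. path_weight M \<pi> n A (\<lambda>_. 1) y \<partial>next_step M \<pi> x \<partial>\<nu>)"
    unfolding emeasure_traj_cylinder[OF M \<nu> A'] by (intro nn_integral_cong) (simp add: A'_def)
  also have "\<dots> = (\<integral>\<^sup>+x. path_weight M \<pi> n A (\<lambda>_. 1) x \<partial>(\<nu> \<bind> next_step M \<pi>))"
    by (rule nn_integral_bind[symmetric, OF measurable_path_weight[OF M _ A]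
          measurable_next_step[OF M prob_algebra_spaceD(2)[OF \<nu>]]]) simp
  finally show "emeasure (distr (traj M \<pi> \<nu>) (Pi\<^sub>M UNIV (\<lambda>_. step_space)) (\<lambda>\<omega> i. \<omega> (Suc i))) {\<omega>. \<forall>i\<le>n. \<omega> i \<in> A i} =
     (\<integral>\<^sup>+x. path_weight M \<pi> n A (\<lambda>_. 1) x \<partial>(\<nu> \<bind> next_step M \<pi>))" .
qed simp

text \<open>Cylinder probabilities are linear in the law of the first step. This is how a trajectory
  is decomposed according to its first state or first action.\<close>

lemma traj_bind_pmf:
  fixes M :: "('s::finite, 'a::finite) mdp"
  assumes M: "mdp M" and f: "\<And>x. f x \<in> space (prob_algebra step_space)"
  shows "traj M \<pi> (measure_pmf p \<bind> f) = measure_pmf p \<bind> (\<lambda>x. traj M \<pi> (f x))"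
proof (rule traj_eqI[OF M bind_pmf_prob_algebra[OF f], symmetric])
  have T: "traj M \<pi> (f x) \<in> space (prob_algebra (Pi\<^sub>M UNIV (\<lambda>_. step_space)))" for x
    by (rule traj_prob_algebra[OF M f])
  note B = prob_algebra_spaceD[OF bind_pmf_prob_algebra[where f="\<lambda>x. traj M \<pi> (f x)", OF T], of p]
  show "prob_space (measure_pmf p \<bind> (\<lambda>x. traj M \<pi> (f x)))"
    "sets (measure_pmf p \<bind> (\<lambda>x. traj M \<pi> (f x))) = sets (Pi\<^sub>M UNIV (\<lambda>_. step_space))"
    using B by auto
  fix n and A :: "nat \<Rightarrow> ('s \<times> 'a \<times> real) set" assume A: "\<And>i. A i \<in> sets step_space"
  have "emeasure (measure_pmf p \<bind> (\<lambda>x. traj M \<pi> (f x))) {\<omega>. \<forall>i\<le>n. \<omega> i \<in> A i} =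
     (\<integral>\<^sup>+x. \<integral>\<^sup>+y. path_weight M \<pi> n A (\<lambda>_. 1) y \<partial>f x \<partial>measure_pmf p)"
    by (subst emeasure_bind[OF _ measurable_pmf_kernel[OF T] cylinder_sets[OF A]])
       (auto intro!: nn_integral_cong emeasure_traj_cylinder M f A)
  also have "\<dots> = (\<integral>\<^sup>+x. path_weight M \<pi> n A (\<lambda>_. 1) x \<partial>(measure_pmf p \<bind> f))"
    by (rule nn_integral_bind[symmetric, OF measurable_path_weight[OF M _ A] measurable_pmf_kernel[OF f]]) simp
  finally show "emeasure (measure_pmf p \<bind> (\<lambda>x. traj M \<pi> (f x))) {\<omega>. \<forall>i\<le>n. \<omega> i \<in> A i} =
     (\<integral>\<^sup>+x. path_weight M \<pi> n A (\<lambda>_. 1) x \<partial>(measure_pmf p \<bind> f))" .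
qed

lemma distr_traj_0:
  fixes M :: "('s::finite, 'a::finite) mdp"
  assumes M: "mdp M" and \<nu>: "\<nu> \<in> space (prob_algebra step_space)"
  shows "distr (traj M \<pi> \<nu>) step_space (\<lambda>\<omega>. \<omega> 0) = \<nu>"
proof (rule measure_eqI)
  note T = prob_space_traj[OF M \<nu>, of \<pi>]
  show "sets (distr (traj M \<pi> \<nu>) step_space (\<lambda>\<omega>. \<omega> 0)) = sets \<nu>"
    using prob_algebra_spaceD(2)[OF \<nu>] by simp
  fix X assume "X \<in> sets (distr (traj M \<pi> \<nu>) step_space (\<lambda>\<omega>. \<omega> 0))"
  then have X: "X \<in> sets step_space" by simp
  have m: "(\<lambda>\<omega>. \<omega> 0) \<in> traj M \<pi> \<nu> \<rightarrow>\<^sub>M step_space"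
    using measurable_component_singleton[of 0 UNIV "\<lambda>_. step_space"] T(2) by (simp cong: measurable_cong_sets)
  have "emeasure (distr (traj M \<pi> \<nu>) step_space (\<lambda>\<omega>. \<omega> 0)) X =
      emeasure (traj M \<pi> \<nu>) {\<omega>. \<forall>i\<le>0::nat. \<omega> i \<in> X}"
    using sets_eq_imp_space_eq[OF T(2)]
    by (subst emeasure_distr[OF m X]) (auto intro!: arg_cong[where f="emeasure _"])
  also have "\<dots> = emeasure \<nu> X"
    using emeasure_traj_cylinder[OF M \<nu>, of "\<lambda>_. X" \<pi> 0] X prob_algebra_spaceD(2)[OF \<nu>] by simp
  finally show "emeasure (distr (traj M \<pi> \<nu>) step_space (\<lambda>\<omega>. \<omega> 0)) X = emeasure \<nu> X" .
qed

section \<open>Returns and Bellman equations\<close>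

text \<open>The next step ignores the reward just received, so the bind over the reward is a bind of
  a constant.\<close>

lemma bind_step_from_sa_next_step:
  fixes M :: "('s::finite, 'a::finite) mdp"
  assumes M: "mdp M"
  shows "step_from_sa M s a \<bind> next_step M \<pi> = step_init M \<pi> (trans M s a)"
proof -
  interpret R: prob_space "reward M s a" using M by (simp add: mdp_def)
  have [measurable_cong]: "sets (reward M s a) = sets borel" using M by (simp add: mdp_def)
  have m: "(\<lambda>r. (s, a, r)) \<in> reward M s a \<rightarrow>\<^sub>M step_space"
    unfolding step_space_def by measurable
  have "step_from_sa M s a \<bind> next_step M \<pi> = reward M s a \<bind> (\<lambda>r. next_step M \<pi> (s, a, r))"
    unfolding step_from_sa_def
    by (rule bind_distr[OF m measurable_next_step[OF M refl] R.not_empty])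
  also have "\<dots> = reward M s a \<bind> (\<lambda>_. step_init M \<pi> (trans M s a))"
    by (simp add: next_step_def step_init_def)
  also have "\<dots> = step_init M \<pi> (trans M s a)"
    using prob_algebra_spaceD(1)[OF step_init_prob[OF M]]
    by (intro bind_const' R.prob_space_axioms prob_space_imp_subprob_space)
  finally show ?thesis .
qed

lemma bind_pmf_next_step:
  fixes M :: "('s::finite, 'a::finite) mdp"
  assumes M: "mdp M" and f: "\<And>x. f x \<in> space (prob_algebra step_space)"
    and g: "\<And>x. f x \<bind> next_step M \<pi> = step_init M \<pi> (g x)"
  shows "(measure_pmf p \<bind> f) \<bind> next_step M \<pi> = step_init M \<pi> (bind_pmf p g)"
proof -
  have "(measure_pmf p \<bind> f) \<bind> next_step M \<pi> = measure_pmf p \<bind> (\<lambda>x. f x \<bind> next_step M \<pi>)"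
    by (rule bind_assoc[OF measurable_pmf_kernel[OF f] measurable_next_step[OF M refl]])
  also have "\<dots> = measure_pmf p \<bind> (\<lambda>x. measure_pmf (g x) \<bind> step_from M \<pi>)"
    by (simp add: g step_init_def)
  also have "\<dots> = (measure_pmf p \<bind> (\<lambda>x. measure_pmf (g x))) \<bind> step_from M \<pi>"
  proof (rule bind_assoc[symmetric])
    show "(\<lambda>x. measure_pmf (g x)) \<in> measure_pmf p \<rightarrow>\<^sub>M subprob_algebra (count_space UNIV)"
      by (rule measurable_pmf_kernel) (simp add: space_prob_algebra measure_pmf.prob_space_axioms)
    show "step_from M \<pi> \<in> count_space UNIV \<rightarrow>\<^sub>M subprob_algebra step_space"
      using measurable_pmf_kernel[OF step_from_prob[OF M]] by simp
  qed
  finally show ?thesis by (simp add: step_init_def measure_pmf_bind)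
qed

text \<open>The laws \<open>step_init M \<pi> \<mu>\<close> are closed under advancing by one step;
  only the state distribution changes. Shifts by any number of steps therefore stay within this
  family.\<close>

lemma bind_step_init_next_step:
  fixes M :: "('s::finite, 'a::finite) mdp"
  assumes M: "mdp M"
  shows "step_init M \<pi> \<mu> \<bind> next_step M \<pi> =
    step_init M \<pi> (bind_pmf \<mu> (\<lambda>s. bind_pmf (\<pi> s) (trans M s)))"
proof -
  have "step_from M \<pi> s \<bind> next_step M \<pi> = step_init M \<pi> (bind_pmf (\<pi> s) (trans M s))" for s
    unfolding step_from_def
    by (rule bind_pmf_next_step[OF M step_from_sa_prob[OF M] bind_step_from_sa_next_step[OF M]])
  then show ?thesis
    unfolding step_init_def[of M \<pi> \<mu>]
    by (rule bind_pmf_next_step[OF M step_from_prob[OF M]])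
qed

lemma traj_step_from:
  fixes M :: "('s::finite, 'a::finite) mdp"
  assumes "mdp M"
  shows "traj M \<pi> (step_from M \<pi> s) = measure_pmf (\<pi> s) \<bind> (\<lambda>a. traj M \<pi> (step_from_sa M s a))"
  unfolding step_from_def by (rule traj_bind_pmf[OF assms step_from_sa_prob[OF assms]])

lemma traj_step_init:
  fixes M :: "('s::finite, 'a::finite) mdp"
  assumes "mdp M"
  shows "traj M \<pi> (step_init M \<pi> \<mu>) = measure_pmf \<mu> \<bind> (\<lambda>s. traj M \<pi> (step_from M \<pi> s))"
  unfolding step_init_def by (rule traj_bind_pmf[OF assms step_from_prob[OF assms]])

section \<open>Almost sure properties along a trajectory\<close>

lemma AE_traj_shift:
  fixes M :: "('s::finite, 'a::finite) mdp"
  assumes M: "mdp M" and \<nu>: "\<nu> \<in> space (prob_algebra step_space)"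
    and P: "Measurable.pred (Pi\<^sub>M UNIV (\<lambda>_. step_space)) P"
  shows "(AE \<omega> in traj M \<pi> (\<nu> \<bind> next_step M \<pi>). P \<omega>) \<longleftrightarrow> (AE \<omega> in traj M \<pi> \<nu>. P (\<lambda>i. \<omega> (Suc i)))"
proof -
  have m: "(\<lambda>\<omega> i. \<omega> (Suc i)) \<in> traj M \<pi> \<nu> \<rightarrow>\<^sub>M Pi\<^sub>M UNIV (\<lambda>_. step_space)"
    using measurable_shift[of 1 step_space] prob_space_traj(2)[OF M \<nu>, of \<pi>]
    by (simp cong: measurable_cong_sets)
  have "{\<omega> \<in> space (Pi\<^sub>M UNIV (\<lambda>_. step_space)). P \<omega>} \<in> sets (Pi\<^sub>M UNIV (\<lambda>_. step_space))"
    using P by measurable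
  from AE_distr_iff[OF m this] show ?thesis
    unfolding traj_shift[OF M \<nu>] .
qed

lemma AE_traj_step_init:
  fixes M :: "('s::finite, 'a::finite) mdp"
  assumes M: "mdp M" and P: "Measurable.pred (Pi\<^sub>M UNIV (\<lambda>_. step_space)) P"
    and AE: "\<And>s a. AE \<omega> in traj M \<pi> (step_from_sa M s a). P \<omega>"
  shows "AE \<omega> in traj M \<pi> (step_init M \<pi> \<mu>). P \<omega>"
proof -
  have "AE \<omega> in traj M \<pi> (step_from M \<pi> s). P \<omega>" for s
    unfolding traj_step_from[OF M]
    by (subst AE_bind[OF measurable_pmf_kernel[OF traj_prob_algebra[OF M step_from_sa_prob[OF M]]] P])
       (intro AE_I2 AE)
  then show ?thesis
    unfolding traj_step_init[OF M]
    by (subst AE_bind[OF measurable_pmf_kernel[OF traj_prob_algebra[OF M step_from_prob[OF M]]] P])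
       simp
qed

lemma AE_traj_step_init_shift:
  fixes M :: "('s::finite, 'a::finite) mdp"
  assumes M: "mdp M" and P: "Measurable.pred (Pi\<^sub>M UNIV (\<lambda>_. step_space)) P"
    and AE: "\<And>s a. AE \<omega> in traj M \<pi> (step_from_sa M s a). P \<omega>"
  shows "AE \<omega> in traj M \<pi> (step_init M \<pi> \<mu>). \<forall>t. P (\<lambda>i. \<omega> (t + i))"
proof (subst AE_all_countable, rule allI)
  fix t
  show "AE \<omega> in traj M \<pi> (step_init M \<pi> \<mu>). P (\<lambda>i. \<omega> (t + i))"
  \<comment> \<open>Each shift replaces \<open>\<mu>\<close> by the state distribution one step
    later, so \<open>\<mu>\<close> must be general.\<close>
  proof (induction t arbitrary: \<mu>)
    case 0
    show ?case using AE_traj_step_init[OF M P AE] by simp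
  next
    case (Suc t)
    have "Measurable.pred (Pi\<^sub>M UNIV (\<lambda>_. step_space)) (\<lambda>\<omega>. P (\<lambda>i. \<omega> (t + i)))"
      by (rule measurable_compose[OF measurable_shift P])
    from AE_traj_shift[OF M step_init_prob[OF M] this] Suc[of "bind_pmf \<mu> (\<lambda>s. bind_pmf (\<pi> s) (trans M s))"]
    have "AE \<omega> in traj M \<pi> (step_init M \<pi> \<mu>). P (\<lambda>i. \<omega> (t + Suc i))"
      unfolding bind_step_init_next_step[OF M, symmetric] by (simp only: add_Suc_right)
    then show ?case by simp
  qed
qed

text \<open>The inequality \<open>j < i\<close> is strict because the step taken in the first
  terminal state still belongs to the episode.\<close>

lemma termination_time_ge_iff:
  "enat i \<le> termination_time M \<omega> \<longleftrightarrow> (\<forall>j<i. fst (\<omega> j) \<notin> terminal M)"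
  by (force simp: termination_time_def le_INF_iff not_le[symmetric])

text \<open>Comparing the \<open>sums\<close> relations also covers divergent series, where
  \<open>suminf\<close> is a default value; so \<open>ret_eq_shift\<close> can be stated for every
  path.\<close>

lemma suminf_shift:
  fixes f :: "nat \<Rightarrow> real"
  assumes "\<And>i. i < n \<Longrightarrow> f i = 0"
  shows "suminf f = (\<Sum>i. f (n + i))"
proof -
  have "f sums s \<longleftrightarrow> (\<lambda>i. f (n + i)) sums s" for s
    using sums_zero_iff_shift[of n f s] assms by (simp add: add.commute)
  then show ?thesis by (simp add: suminf_def)
qed

text \<open>Up to termination, shifting the path just shifts the termination time. If the episode
  had ended before t, the left side would be an empty sum, while the shifted path would have
  forgotten the earlier terminal state.\<close>

lemma ret_eq_shift:
  assumes "enat t \<le> termination_time M \<omega>"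
  shows "ret M t \<omega> = ret M 0 (\<lambda>i. \<omega> (t + i))"
proof -
  have "enat (t + i) \<le> termination_time M \<omega> \<longleftrightarrow> enat i \<le> termination_time M (\<lambda>i. \<omega> (t + i))" for i
  proof
    assume "enat (t + i) \<le> termination_time M \<omega>"
    then show "enat i \<le> termination_time M (\<lambda>i. \<omega> (t + i))"
      by (auto simp: termination_time_ge_iff)
  next
    assume R: "enat i \<le> termination_time M (\<lambda>i. \<omega> (t + i))"
    have "fst (\<omega> j) \<notin> terminal M" if "j < t + i" for j
    proof (cases "j < t")
      case True
      with assms show ?thesis by (simp add: termination_time_ge_iff)
    next
      case False
      with R that show ?thesis
        by (auto simp: termination_time_ge_iff dest!: spec[of _ "j - t"])
    qed
    then show "enat (t + i) \<le> termination_time M \<omega>" by (simp add: termination_time_ge_iff)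
  qed
  then show ?thesis
    unfolding ret_def by (subst suminf_shift[of t]) (auto intro!: suminf_cong)
qed

lemma ret_0:
  "ret M 0 \<omega> = (\<Sum>i. if enat i \<le> termination_time M \<omega> then discount M ^ i * snd (snd (\<omega> i)) else 0)"
  by (simp add: ret_def cong: if_cong)

lemma summable_return:
  assumes "\<And>i. \<bar>snd (snd (\<omega> i))\<bar> \<le> B" "0 \<le> discount M" "discount M < 1"
  shows "summable (\<lambda>i. if enat i \<le> termination_time M \<omega> then discount M ^ i * snd (snd (\<omega> i)) else 0)" (is "summable ?f")
    and "\<bar>ret M 0 \<omega>\<bar> \<le> B / (1 - discount M)"
proof -
  have B: "0 \<le> B" using assms(1)[of 0] by linarith
  have le: "norm (?f i) \<le> B * discount M ^ i" for i
    using mult_right_mono[OF assms(1)[of i], of "discount M ^ i"] assms B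
    by (simp add: abs_mult mult.commute)
  have S: "(\<lambda>i. B * discount M ^ i) sums (B / (1 - discount M))"
    using sums_mult[OF geometric_sums[of "discount M"], of B] assms by simp
  show "summable ?f"
    by (rule summable_comparison_test'[OF sums_summable[OF S] le])
  have "norm (suminf ?f) \<le> (\<Sum>i. B * discount M ^ i)"
    by (rule norm_suminf_le[OF le sums_summable[OF S]])
  then show "\<bar>ret M 0 \<omega>\<bar> \<le> B / (1 - discount M)"
    using sums_unique[OF S] by (simp add: ret_0)
qed

lemma ret_Suc:
  assumes "\<And>i. \<bar>snd (snd (\<omega> i))\<bar> \<le> B" "0 \<le> discount M" "discount M < 1"
  shows "ret M 0 \<omega> = snd (snd (\<omega> 0)) +
    discount M * (if fst (\<omega> 0) \<in> terminal M then 0 else ret M 0 (\<lambda>i. \<omega> (Suc i)))"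
proof -
  let ?f = "\<lambda>i. if enat i \<le> termination_time M \<omega> then discount M ^ i * snd (snd (\<omega> i)) else 0"
  let ?\<omega> = "\<lambda>i. \<omega> (Suc i)"
  let ?g = "\<lambda>i. if enat i \<le> termination_time M ?\<omega> then discount M ^ i * snd (snd (?\<omega> i)) else 0"
  have f: "summable ?f" and g: "summable ?g" by (rule summable_return(1)[OF assms])+
  \<comment> \<open>If step 0 is terminal, it is the last step that counts and all later terms
    vanish.\<close>
  have "?f (Suc i) = discount M * (if fst (\<omega> 0) \<in> terminal M then 0 else ?g i)" for i
    by (auto simp: termination_time_ge_iff All_less_Suc2)
  then have "(\<Sum>i. ?f (Suc i)) = discount M * (if fst (\<omega> 0) \<in> terminal M then 0 else suminf ?g)"
    using suminf_mult[OF g, of "discount M"] by (cases "fst (\<omega> 0) \<in> terminal M") simp_all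
  moreover have "suminf ?f = ?f 0 + (\<Sum>i. ?f (Suc i))"
    using suminf_split_initial_segment[OF f, of 1] by (simp cong: if_cong)
  ultimately show ?thesis by (simp add: ret_0 zero_enat_def[symmetric])
qed

lemma measurable_step:
  "(\<lambda>\<omega>. snd (snd (\<omega> i))) \<in> borel_measurable (Pi\<^sub>M UNIV (\<lambda>_. step_space))"
  "(\<lambda>\<omega>. fst (\<omega> i)) \<in> Pi\<^sub>M UNIV (\<lambda>_. step_space) \<rightarrow>\<^sub>M count_space UNIV"
  "(\<lambda>\<omega>. fst (snd (\<omega> i))) \<in> Pi\<^sub>M UNIV (\<lambda>_. step_space) \<rightarrow>\<^sub>M count_space UNIV"
  unfolding step_space_def by measurable

section \<open>Bounded rewards and integrability of the return\<close>

lemma AE_step_from_sa: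
  fixes M :: "('s::finite, 'a::finite) mdp"
  assumes M: "mdp M"
  shows "AE x in step_from_sa M s a. fst x = s"
    and "AE r in reward M s a. \<bar>r\<bar> \<le> B \<Longrightarrow> AE x in step_from_sa M s a. \<bar>snd (snd x)\<bar> \<le> B"
proof -
  have [measurable_cong]: "sets (reward M s a) = sets borel" using M by (simp add: mdp_def)
  have m: "(\<lambda>r. (s, a, r)) \<in> reward M s a \<rightarrow>\<^sub>M step_space"
    unfolding step_space_def by measurable
  have S: "{x \<in> space step_space. fst x = s} \<in> sets (step_space :: ('s \<times> 'a \<times> real) measure)"
    "{x \<in> space step_space. \<bar>snd (snd x)\<bar> \<le> B} \<in> sets (step_space :: ('s \<times> 'a \<times> real) measure)"
    unfolding step_space_def by measurable
  show "AE x in step_from_sa M s a. fst x = s"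
    unfolding step_from_sa_def by (subst AE_distr_iff[OF m S(1)]) simp
  show "AE r in reward M s a. \<bar>r\<bar> \<le> B \<Longrightarrow> AE x in step_from_sa M s a. \<bar>snd (snd x)\<bar> \<le> B"
    unfolding step_from_sa_def by (subst AE_distr_iff[OF m S(2)]) simp
qed

lemma AE_traj_0:
  fixes M :: "('s::finite, 'a::finite) mdp"
  assumes M: "mdp M" and \<nu>: "\<nu> \<in> space (prob_algebra step_space)" and AE: "AE x in \<nu>. P x"
  shows "AE \<omega> in traj M \<pi> \<nu>. P (\<omega> 0)"
proof (rule AE_distrD[where f="\<lambda>\<omega>. \<omega> 0" and M'=step_space and P=P])
  show "(\<lambda>\<omega>. \<omega> 0) \<in> traj M \<pi> \<nu> \<rightarrow>\<^sub>M step_space"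
    using measurable_component_singleton[of 0 UNIV "\<lambda>_. step_space"] prob_space_traj(2)[OF M \<nu>, of \<pi>]
    by (simp cong: measurable_cong_sets)
  show "AE x in distr (traj M \<pi> \<nu>) step_space (\<lambda>\<omega>. \<omega> 0). P x"
    using AE unfolding distr_traj_0[OF M \<nu>] .
qed

lemma AE_reward_bounded:
  fixes M :: "('s::finite, 'a::finite) mdp"
  assumes M: "mdp M" and B: "\<And>s a. AE r in reward M s a. \<bar>r\<bar> \<le> B"
  shows "AE \<omega> in traj M \<pi> (step_from_sa M s a). \<forall>i. \<bar>snd (snd (\<omega> i))\<bar> \<le> B"
proof -
  note [measurable] = measurable_step(1)
  have 0: "AE \<omega> in traj M \<pi> (step_from_sa M s a). \<bar>snd (snd (\<omega> 0))\<bar> \<le> B" for s a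
    by (rule AE_traj_0[OF M step_from_sa_prob[OF M] AE_step_from_sa(2)[OF M B]])
  \<comment> \<open>The form \<open>t + 0\<close> matches the shift lemma for a property that looks
    only at step 0 of the shifted path.\<close>
  have "AE \<omega> in traj M \<pi> (step_init M \<pi> (trans M s a)). \<forall>t. \<bar>snd (snd (\<omega> (t + 0)))\<bar> \<le> B"
    by (rule AE_traj_step_init_shift[OF M _ 0]) measurable
  then have "AE \<omega> in traj M \<pi> (step_from_sa M s a \<bind> next_step M \<pi>). \<forall>t. \<bar>snd (snd (\<omega> t))\<bar> \<le> B"
    unfolding bind_step_from_sa_next_step[OF M] by simp
  then have "AE \<omega> in traj M \<pi> (step_from_sa M s a). \<forall>t. \<bar>snd (snd (\<omega> (Suc t)))\<bar> \<le> B"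
    by (subst (asm) AE_traj_shift[OF M step_from_sa_prob[OF M]]) simp_all
  with 0[of s a] show ?thesis
  proof eventually_elim
    case (elim \<omega>)
    then show ?case using not0_implies_Suc by metis
  qed
qed

lemma integrable_ret:
  fixes M :: "('s::finite, 'a::finite) mdp"
  assumes M: "mdp M"
  shows "integrable (traj M \<pi> (step_from_sa M s a)) (ret M 0)"
proof -
  obtain B where B: "\<And>s a. AE r in reward M s a. \<bar>r\<bar> \<le> B" using M by (auto simp: mdp_def)
  note T = prob_space_traj[OF M step_from_sa_prob[OF M], of \<pi> s a]
  interpret prob_space "traj M \<pi> (step_from_sa M s a)" by (rule T)
  show ?thesis
  proof (rule integrable_const_bound)
    show "ret M 0 \<in> borel_measurable (traj M \<pi> (step_from_sa M s a))"
      using ret_measurable[of M 0] T(2) by (simp cong: measurable_cong_sets)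
    show "AE \<omega> in traj M \<pi> (step_from_sa M s a). norm (ret M 0 \<omega>) \<le> B / (1 - discount M)"
      using AE_reward_bounded[OF M B, of \<pi> s a]
    proof eventually_elim
      case (elim \<omega>)
      then show ?case using summable_return(2)[of \<omega> B M] M by (simp add: mdp_def)
    qed
  qed
qed

text \<open>The law of total expectation for a finite mixture. The bind rule is applied to
  nonnegative integrals, and the signed integral is recovered from its positive and negative
  parts.\<close>

lemma
  fixes p :: "'x::finite pmf" and f :: "'y \<Rightarrow> real"
  assumes N: "\<And>x. N x \<in> space (prob_algebra K)" and f: "f \<in> borel_measurable K"
    and int: "\<And>x. integrable (N x) f"
  shows integrable_bind_pmf: "integrable (measure_pmf p \<bind> N) f"
    and integral_bind_finite_pmf: "(\<integral>y. f y \<partial>(measure_pmf p \<bind> N)) = (\<Sum>x\<in>UNIV. pmf p x * (\<integral>y. f y \<partial>N x))"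
proof -
  have nn: "(\<integral>\<^sup>+y. g y \<partial>(measure_pmf p \<bind> N)) = (\<Sum>x\<in>UNIV. ennreal (pmf p x) * (\<integral>\<^sup>+y. g y \<partial>N x))"
    if "g \<in> borel_measurable K" for g
    by (subst nn_integral_bind[OF that measurable_pmf_kernel[OF N]])
       (simp add: nn_integral_measure_pmf nn_integral_count_space_finite)
  have fin: "(\<integral>\<^sup>+y. ennreal (norm (f y)) \<partial>N x) < \<infinity>"
    "(\<integral>\<^sup>+y. ennreal (f y) \<partial>N x) < \<infinity>" "(\<integral>\<^sup>+y. ennreal (- f y) \<partial>N x) < \<infinity>" for x
    using int[of x] integrable_iff_bounded[of "N x" f] by (auto simp: real_integrable_def less_top)
  show *: "integrable (measure_pmf p \<bind> N) f"
    unfolding integrable_iff_bounded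
  proof
    show "f \<in> borel_measurable (measure_pmf p \<bind> N)"
      using f prob_algebra_spaceD(2)[OF bind_pmf_prob_algebra[where f=N and p=p, OF N]] by (simp cong: measurable_cong_sets)
    show "(\<integral>\<^sup>+y. ennreal (norm (f y)) \<partial>(measure_pmf p \<bind> N)) < \<infinity>"
      using f fin(1) by (subst nn) (auto simp: ennreal_mult_less_top)
  qed
  \<comment> \<open>\<open>enn2real\<close> sends \<open>\<infinity>\<close> to 0 and is additive
    only on finite values, hence the finiteness facts \<open>fin\<close>.\<close>
  have "enn2real (\<integral>\<^sup>+y. ennreal (g y) \<partial>(measure_pmf p \<bind> N)) =
      (\<Sum>x\<in>UNIV. pmf p x * enn2real (\<integral>\<^sup>+y. ennreal (g y) \<partial>N x))"
    if "g \<in> borel_measurable K" "\<And>x. (\<integral>\<^sup>+y. ennreal (g y) \<partial>N x) < \<infinity>" for g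
    using that by (subst nn) (auto simp: enn2real_sum ennreal_mult_less_top enn2real_mult)
  from this[of f] this[of "\<lambda>y. - f y"] show
    "(\<integral>y. f y \<partial>(measure_pmf p \<bind> N)) = (\<Sum>x\<in>UNIV. pmf p x * (\<integral>y. f y \<partial>N x))"
    using f fin by (simp add: real_lebesgue_integral_def[OF *] real_lebesgue_integral_def[OF int]
        sum_subtractf right_diff_distrib)
qed

section \<open>Bellman equations\<close>

lemma V_eq_sum_Q:
  fixes M :: "('s::finite, 'a::finite) mdp"
  assumes M: "mdp M"
  shows "V M \<pi> s = (\<Sum>a\<in>UNIV. pmf (\<pi> s) a * Q M \<pi> s a)"
  unfolding V_def Q_def traj_step_from[OF M]
  by (rule integral_bind_finite_pmf[OF traj_prob_algebra[OF M step_from_sa_prob[OF M]]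
        ret_measurable integrable_ret[OF M]])

text \<open>The expectation of \<open>ret_Suc\<close>: the first state is almost surely
  \<open>s\<close>, which decides the terminal case, and the shifted path has the law of a start
  from \<open>trans M s a\<close>.\<close>

lemma Q_bellman:
  fixes M :: "('s::finite, 'a::finite) mdp"
  assumes M: "mdp M"
  shows "Q M \<pi> s a = (\<integral>x. snd (snd x) \<partial>step_from_sa M s a) +
    (if s \<in> terminal M then 0 else discount M * (\<Sum>s'\<in>UNIV. pmf (trans M s a) s' * V M \<pi> s'))"
proof -
  obtain B where B: "\<And>s a. AE r in reward M s a. \<bar>r\<bar> \<le> B" using M by (auto simp: mdp_def)
  note \<nu> = step_from_sa_prob[OF M, of s a]
  let ?T = "traj M \<pi> (step_from_sa M s a)" and ?T' = "traj M \<pi> (step_init M \<pi> (trans M s a))"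
  note T = prob_space_traj[OF M \<nu>, of \<pi>]
  interpret T: prob_space ?T by (rule T)
  have m0: "(\<lambda>\<omega>. \<omega> 0) \<in> ?T \<rightarrow>\<^sub>M step_space"
    using measurable_component_singleton[of 0 UNIV "\<lambda>_. step_space"] T(2)
    by (simp cong: measurable_cong_sets)
  have m1: "(\<lambda>\<omega> i. \<omega> (Suc i)) \<in> ?T \<rightarrow>\<^sub>M Pi\<^sub>M UNIV (\<lambda>_. step_space)"
    using measurable_shift[of 1 step_space] T(2) by (simp cong: measurable_cong_sets)
  have mr: "(\<lambda>\<omega>. snd (snd (\<omega> 0))) \<in> borel_measurable ?T"
    using measurable_step(1)[of 0] T(2) by (simp cong: measurable_cong_sets)
  have mret: "ret M 0 \<in> borel_measurable ?T"
    using ret_measurable[of M 0] T(2) by (simp cong: measurable_cong_sets)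
  have mret1: "(\<lambda>\<omega>. ret M 0 (\<lambda>i. \<omega> (Suc i))) \<in> borel_measurable ?T"
    by (rule measurable_compose[OF m1 ret_measurable])
  have distr: "distr ?T (Pi\<^sub>M UNIV (\<lambda>_. step_space)) (\<lambda>\<omega> i. \<omega> (Suc i)) = ?T'"
    by (simp add: traj_shift[OF M \<nu>] bind_step_from_sa_next_step[OF M])
  have intV: "integrable (traj M \<pi> (step_from M \<pi> s')) (ret M 0)" for s'
    unfolding traj_step_from[OF M]
    by (rule integrable_bind_pmf[OF traj_prob_algebra[OF M step_from_sa_prob[OF M]]
        ret_measurable integrable_ret[OF M]])
  note T' = integrable_bind_pmf[where N="\<lambda>s. traj M \<pi> (step_from M \<pi> s)", OF traj_prob_algebra[OF M step_from_prob[OF M]] ret_measurable intV]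
    integral_bind_finite_pmf[where N="\<lambda>s. traj M \<pi> (step_from M \<pi> s)", OF traj_prob_algebra[OF M step_from_prob[OF M]] ret_measurable intV]
  have int1: "integrable ?T (\<lambda>\<omega>. ret M 0 (\<lambda>i. \<omega> (Suc i)))"
    using integrable_distr[OF m1, of "ret M 0"] T'(1) by (simp add: distr traj_step_init[OF M])
  have bounded: "AE \<omega> in ?T. \<forall>i. \<bar>snd (snd (\<omega> i))\<bar> \<le> B"
    by (rule AE_reward_bounded[OF M B])
  have int0: "integrable ?T (\<lambda>\<omega>. snd (snd (\<omega> 0)))"
    using bounded by (intro T.integrable_const_bound[of _ B] mr) (auto elim: eventually_mono)
  have "AE \<omega> in ?T. fst (\<omega> 0) = s"
    by (rule AE_traj_0[OF M \<nu> AE_step_from_sa(1)[OF M]])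
  then have AE: "AE \<omega> in ?T. ret M 0 \<omega> = snd (snd (\<omega> 0)) +
      (if s \<in> terminal M then 0 else discount M) * ret M 0 (\<lambda>i. \<omega> (Suc i))"
    using bounded
  proof eventually_elim
    case (elim \<omega>)
    then show ?case using ret_Suc[of \<omega> B M] M by (simp add: mdp_def)
  qed
  have "Q M \<pi> s a = (\<integral>\<omega>. snd (snd (\<omega> 0)) + (if s \<in> terminal M then 0 else discount M) * ret M 0 (\<lambda>i. \<omega> (Suc i)) \<partial>?T)"
    unfolding Q_def using AE mr mret1 mret by (intro integral_cong_AE) simp_all
  also have "\<dots> = (\<integral>\<omega>. snd (snd (\<omega> 0)) \<partial>?T) +
      (if s \<in> terminal M then 0 else discount M) * (\<integral>\<omega>. ret M 0 (\<lambda>i. \<omega> (Suc i)) \<partial>?T)"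
    using int0 int1 by simp
  also have "(\<integral>\<omega>. ret M 0 (\<lambda>i. \<omega> (Suc i)) \<partial>?T) = (\<integral>\<omega>. ret M 0 \<omega> \<partial>?T')"
    using integral_distr[OF m1 ret_measurable, of M 0] by (simp add: distr)
  also have "\<dots> = (\<Sum>s'\<in>UNIV. pmf (trans M s a) s' * V M \<pi> s')"
    unfolding traj_step_init[OF M] V_def by (rule T'(2))
  also have "(\<integral>\<omega>. snd (snd (\<omega> 0)) \<partial>?T) = (\<integral>x. snd (snd x) \<partial>step_from_sa M s a)"
    by (subst (2) distr_traj_0[OF M \<nu>, of \<pi>, symmetric], subst integral_distr[OF m0])
       (simp_all add: step_space_def)
  finally show ?thesis by simp
qed

lemma V_bellman:
  fixes M :: "('s::finite, 'a::finite) mdp"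
  assumes M: "mdp M"
  shows "V M \<pi> s = (\<Sum>a\<in>UNIV. pmf (\<pi> s) a * ((\<integral>x. snd (snd x) \<partial>step_from_sa M s a) +
    (if s \<in> terminal M then 0 else discount M * (\<Sum>s'\<in>UNIV. pmf (trans M s a) s' * V M \<pi> s'))))"
  unfolding V_eq_sum_Q[OF M, of \<pi> s] Q_bellman[OF M] ..

section \<open>Comparing the values of two policies\<close>

lemma sum_pmf_mult_ge:
  fixes p :: "'x::finite pmf"
  assumes "\<And>x. c \<le> f x"
  shows "c \<le> (\<Sum>x\<in>UNIV. pmf p x * f x)"
proof -
  have "c = (\<Sum>x\<in>UNIV. pmf p x * c)"
    by (simp add: sum_distrib_right[symmetric] sum_pmf_eq_1)
  also have "\<dots> \<le> (\<Sum>x\<in>UNIV. pmf p x * f x)"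
    by (intro sum_mono mult_left_mono assms) simp
  finally show ?thesis .
qed

lemma abs_sum_pmf_mult_le:
  fixes p :: "'x::finite pmf"
  assumes "\<And>x. \<bar>f x\<bar> \<le> c"
  shows "\<bar>\<Sum>x\<in>UNIV. pmf p x * f x\<bar> \<le> c"
proof -
  have "- c \<le> (\<Sum>x\<in>UNIV. pmf p x * f x)"
    by (rule sum_pmf_mult_ge) (use assms in \<open>simp add: abs_le_iff minus_le_iff\<close>)
  moreover have "- c \<le> (\<Sum>x\<in>UNIV. pmf p x * - f x)"
    by (rule sum_pmf_mult_ge) (use assms in \<open>simp add: abs_le_iff\<close>)
  ultimately show ?thesis by (simp add: sum_negf abs_le_iff minus_le_iff)
qed

text \<open>The factor 1 / (1 - \<open>discount M\<close>) comes from solving a single inequality at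
  the worst state, \<open>\<Delta> s0 \<ge> discount M * \<Delta> s0 - c\<close>, instead of summing
  discounted losses over time.\<close>

lemma V_diff_ge:
  fixes M :: "('s::finite, 'a::finite) mdp"
  assumes M: "mdp M" and c: "0 \<le> c"
    and adv: "\<And>s. - c \<le> (\<Sum>a\<in>UNIV. Q M \<pi>\<^sub>b s a * (pmf (\<pi> s) a - pmf (\<pi>\<^sub>b s) a))"
  shows "- (c / (1 - discount M)) \<le> V M \<pi> s - V M \<pi>\<^sub>b s"
proof -
  have \<gamma>: "0 \<le> discount M" "discount M < 1" using M by (auto simp: mdp_def)
  define \<Delta> where "\<Delta> s = V M \<pi> s - V M \<pi>\<^sub>b s" for s
  have "finite (range \<Delta>)" "range \<Delta> \<noteq> {}" by auto
  from Min_in[OF this] obtain s0 where s0: "\<Delta> s0 = Min (range \<Delta>)" by force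
  have min: "\<Delta> s0 \<le> \<Delta> s" for s using s0 by simp
  have Qd: "Q M \<pi> s0 a - Q M \<pi>\<^sub>b s0 a =
      (if s0 \<in> terminal M then 0 else discount M * (\<Sum>s'\<in>UNIV. pmf (trans M s0 a) s' * \<Delta> s'))" for a
    by (simp add: Q_bellman[OF M] \<Delta>_def right_diff_distrib sum_subtractf)
  \<comment> \<open>Adding and subtracting the average of \<open>Q M \<pi>\<^sub>b\<close> under
    \<open>\<pi>\<close> separates the later differences in value from the advantage at
    \<open>s0\<close>.\<close>
  have "\<Delta> s0 = (\<Sum>a\<in>UNIV. pmf (\<pi> s0) a * (Q M \<pi> s0 a - Q M \<pi>\<^sub>b s0 a)) +
      (\<Sum>a\<in>UNIV. Q M \<pi>\<^sub>b s0 a * (pmf (\<pi> s0) a - pmf (\<pi>\<^sub>b s0) a))"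
    by (simp add: \<Delta>_def V_eq_sum_Q[OF M] sum.distrib[symmetric] sum_subtractf[symmetric] algebra_simps)
  \<comment> \<open>The 0 covers a terminal \<open>s0\<close>, after which nothing follows;
    elsewhere the average of \<open>\<Delta>\<close> over the successors is at least its
    minimum.\<close>
  moreover have "min 0 (discount M * \<Delta> s0) \<le> Q M \<pi> s0 a - Q M \<pi>\<^sub>b s0 a" for a
    using mult_left_mono[OF sum_pmf_mult_ge[of "\<Delta> s0" \<Delta> "trans M s0 a", OF min] \<gamma>(1)] by (auto simp: Qd min_le_iff_disj)
  then have "min 0 (discount M * \<Delta> s0) \<le> (\<Sum>a\<in>UNIV. pmf (\<pi> s0) a * (Q M \<pi> s0 a - Q M \<pi>\<^sub>b s0 a))"
    by (rule sum_pmf_mult_ge)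
  ultimately have *: "min 0 (discount M * \<Delta> s0) - c \<le> \<Delta> s0"
    using adv[of s0] by linarith
  \<comment> \<open>A nonnegative minimum exceeds the nonpositive bound anyway; a negative one makes
    \<open>discount M * \<Delta> s0\<close> the smaller argument of \<open>min\<close>, and it can
    be moved to the other side.\<close>
  have "- (c / (1 - discount M)) \<le> \<Delta> s0"
  proof (cases "0 \<le> \<Delta> s0")
    case True
    moreover have "0 \<le> c / (1 - discount M)" using c \<gamma> by simp
    ultimately show ?thesis by linarith
  next
    case False
    then have "discount M * \<Delta> s0 \<le> 0" using \<gamma> by (simp add: mult_nonneg_nonpos)
    with * have "- \<Delta> s0 * (1 - discount M) \<le> c" by (simp add: algebra_simps)
    then have "- \<Delta> s0 \<le> c / (1 - discount M)" using \<gamma> by (subst pos_le_divide_eq) simp_all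
    then show ?thesis by simp
  qed
  with min[of s] show ?thesis unfolding \<Delta>_def by linarith
qed

text \<open>
  Value iteration is only used to see that \<open>V M \<pi> s\<close> depends measurably on the probabilities \<open>pmf (\<pi> s) a\<close>.
\<close>

primrec value_iteration :: "('s::finite, 'a::finite) mdp \<Rightarrow> ('s, 'a) policy \<Rightarrow> nat \<Rightarrow> 's \<Rightarrow> real" where
  "value_iteration M \<pi> 0 s = 0"
| "value_iteration M \<pi> (Suc n) s =
     (\<Sum>a\<in>UNIV. pmf (\<pi> s) a * ((\<integral>x. snd (snd x) \<partial>step_from_sa M s a) +
       (if s \<in> terminal M then 0
        else discount M * (\<Sum>s'\<in>UNIV. pmf (trans M s a) s' * value_iteration M \<pi> n s'))))"

lemma value_iteration_tendsto:
  fixes M :: "('s::finite, 'a::finite) mdp"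
  assumes M: "mdp M"
  shows "(\<lambda>n. value_iteration M \<pi> n s) \<longlonglongrightarrow> V M \<pi> s"
proof -
  have \<gamma>: "0 \<le> discount M" "discount M < 1" using M by (auto simp: mdp_def)
  \<comment> \<open>The error of the initial guess 0; each iteration contracts it by
    \<open>discount M\<close>.\<close>
  define C where "C = (MAX s. \<bar>V M \<pi> s\<bar>)"
  have C: "\<bar>V M \<pi> s\<bar> \<le> C" for s by (simp add: C_def)
  have "\<bar>value_iteration M \<pi> n s - V M \<pi> s\<bar> \<le> discount M ^ n * C" for n
  proof (induction n arbitrary: s)
    case 0
    show ?case using C by simp
  next
    case (Suc n)
    let ?D = "\<lambda>s. value_iteration M \<pi> n s - V M \<pi> s"
    have "value_iteration M \<pi> (Suc n) s - V M \<pi> s = (\<Sum>a\<in>UNIV. pmf (\<pi> s) a *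
       (if s \<in> terminal M then 0 else discount M * (\<Sum>s'\<in>UNIV. pmf (trans M s a) s' * ?D s')))"
      unfolding V_bellman[OF M, of \<pi> s] value_iteration.simps sum_subtractf[symmetric]
        right_diff_distrib[symmetric]
      by (intro sum.cong refl arg_cong2[where f="(*)"])
         (simp add: right_diff_distrib sum_subtractf)
    moreover have "\<bar>if s \<in> terminal M then 0
        else discount M * (\<Sum>s'\<in>UNIV. pmf (trans M s a) s' * ?D s')\<bar> \<le> discount M ^ Suc n * C" for a
    proof -
      have "0 \<le> C" using C[of s] by linarith
      moreover have "\<bar>\<Sum>s'\<in>UNIV. pmf (trans M s a) s' * ?D s'\<bar> \<le> discount M ^ n * C"
        by (rule abs_sum_pmf_mult_le[OF Suc])
      then have "discount M * \<bar>\<Sum>s'\<in>UNIV. pmf (trans M s a) s' * ?D s'\<bar> \<le> discount M * (discount M ^ n * C)"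
        using \<gamma>(1) by (rule mult_left_mono)
      ultimately show ?thesis using \<gamma> by (simp add: abs_mult mult.assoc)
    qed
    ultimately show ?case by (simp only: abs_sum_pmf_mult_le)
  qed
  then have "\<forall>\<^sub>F n in sequentially. norm (value_iteration M \<pi> n s - V M \<pi> s) \<le> discount M ^ n * C"
    by simp
  moreover have "(\<lambda>n. discount M ^ n * C) \<longlonglongrightarrow> 0"
    using \<gamma> by (intro tendsto_mult_left_zero LIMSEQ_power_zero) simp
  ultimately have "(\<lambda>n. value_iteration M \<pi> n s - V M \<pi> s) \<longlonglongrightarrow> 0"
    by (rule Lim_null_comparison)
  then show ?thesis by (simp add: LIM_zero_iff)
qed

text \<open>Every iterate is a polynomial in the action probabilities, and pointwise limits preserve
  measurability. Here \<open>x\<close> is the data set on which the policy depends.\<close>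

lemma measurable_V:
  fixes M :: "('s::finite, 'a::finite) mdp"
  assumes M: "mdp M" and [measurable]: "\<And>s a. (\<lambda>x. pmf (\<pi> x s) a) \<in> borel_measurable N"
  shows "(\<lambda>x. V M (\<pi> x) s) \<in> borel_measurable N"
proof (rule borel_measurable_LIMSEQ_real)
  show "(\<lambda>n. value_iteration M (\<pi> x) n s) \<longlonglongrightarrow> V M (\<pi> x) s" for x
    by (rule value_iteration_tendsto[OF M])
  show "(\<lambda>x. value_iteration M (\<pi> x) n s) \<in> borel_measurable N" for n
  proof (induction n arbitrary: s)
    case (Suc n)
    note [measurable] = Suc
    show ?case by (cases "s \<in> terminal M") (simp_all, measurable)
  qed simp
qed

section \<open>Concentration of the Monte-Carlo estimates\<close>

lemma return_bound_nonneg: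
  fixes M :: "('s::finite, 'a::finite) mdp"
  assumes M: "mdp M" and G: "return_bound M G"
  shows "0 \<le> G"
proof -
  fix \<pi> :: "('s, 'a) policy" and s a
  interpret prob_space "traj M \<pi> (step_from_sa M s a)"
    by (rule prob_space_traj(1)[OF M step_from_sa_prob[OF M]])
  have "AE \<omega> in traj M \<pi> (step_from_sa M s a). 0 \<le> G"
    using G[unfolded return_bound_def, rule_format, of \<pi> s a] by eventually_elim linarith
  then show ?thesis by (simp add: AE_const)
qed

text \<open>Transports \<open>return_bound\<close> to all times of an episode: after a shift by t
  the process starts from a mixture of pairs, and up to termination the return from t is the return
  from 0 of the shifted path.\<close>

lemma AE_ret_bounded:
  fixes M :: "('s::finite, 'a::finite) mdp"
  assumes M: "mdp M" and G: "return_bound M G"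
  shows "AE \<omega> in traj M \<pi> (step_init M \<pi> \<mu>). \<forall>t. enat t \<le> termination_time M \<omega> \<longrightarrow> \<bar>ret M t \<omega>\<bar> \<le> G"
proof -
  note [measurable] = ret_measurable[of M 0]
  have "AE \<omega> in traj M \<pi> (step_init M \<pi> \<mu>). \<forall>t. \<bar>ret M 0 (\<lambda>i. \<omega> (t + i))\<bar> \<le> G"
    by (rule AE_traj_step_init_shift[OF M]) (use G in \<open>simp_all add: return_bound_def\<close>)
  then show ?thesis by eventually_elim (simp add: ret_eq_shift)
qed

lemma prob_space_data:
  fixes M :: "('s::finite, 'a::finite) mdp"
  assumes M: "mdp M"
  shows "prob_space (data_measure M \<pi>\<^sub>b \<mu> K)"
  unfolding data_measure_def by (intro prob_space_PiM prob_space_traj(1)[OF M step_init_prob[OF M]])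

lemma AE_data_ret_bounded:
  fixes M :: "('s::finite, 'a::finite) mdp"
  assumes M: "mdp M" and G: "return_bound M G"
  shows "AE D in data_measure M \<pi>\<^sub>b \<mu> K.
    \<forall>k<K. \<forall>t. enat t \<le> termination_time M (D k) \<longrightarrow> \<bar>ret M t (D k)\<bar> \<le> G"
proof -
  have "AE D in data_measure M \<pi>\<^sub>b \<mu> K. \<forall>k\<in>{..<K}. \<forall>t. enat t \<le> termination_time M (D k) \<longrightarrow> \<bar>ret M t (D k)\<bar> \<le> G"
    unfolding data_measure_def
    by (intro AE_finite_allI AE_PiM_component prob_space_traj(1)[OF M step_init_prob[OF M]] AE_ret_bounded[OF M G]) simp_all
  then show ?thesis by (simp add: lessThan_def)
qed

section \<open>Measurability of the visits and the estimates\<close>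

lemma measurable_episode:
  fixes M :: "('s::finite, 'a::finite) mdp"
  assumes M: "mdp M" and k: "k < K"
  shows "(\<lambda>D. D k) \<in> data_measure M \<pi>\<^sub>b \<mu> K \<rightarrow>\<^sub>M Pi\<^sub>M UNIV (\<lambda>_. step_space)"
proof -
  have "(\<lambda>D. D k) \<in> data_measure M \<pi>\<^sub>b \<mu> K \<rightarrow>\<^sub>M traj M \<pi>\<^sub>b (step_init M \<pi>\<^sub>b \<mu>)"
    unfolding data_measure_def using k by (intro measurable_component_singleton) simp
  then show ?thesis
    using prob_space_traj(2)[OF M step_init_prob[OF M], of \<pi>\<^sub>b \<pi>\<^sub>b \<mu>] by (simp cong: measurable_cong_sets)
qed

lemma measurable_count_spaceI:
  assumes A: "countable A" and f: "f \<in> space M \<rightarrow> A"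
    and sets: "\<And>a. a \<in> A \<Longrightarrow> f -` {a} \<inter> space M \<in> sets M"
  shows "f \<in> M \<rightarrow>\<^sub>M count_space A"
proof (rule measurableI)
  fix X assume "X \<in> sets (count_space A)"
  then have "X \<subseteq> A" by simp
  then have "(\<Union>a\<in>X. f -` {a} \<inter> space M) \<in> sets M"
    using sets by (intro sets.countable_UN' countable_subset[OF _ A]) auto
  also have "(\<Union>a\<in>X. f -` {a} \<inter> space M) = f -` X \<inter> space M" by auto
  finally show "f -` X \<inter> space M \<in> sets M" .
qed (use f in auto)

text \<open>Only the coordinates \<open>D k\<close> with \<open>k < K\<close> are known to be
  measurable, so the recorded sets are first confined to \<open>{..<K} \<times> UNIV\<close>. There
  are countably many such finite sets, which allows the recorded set to be frozen at a value
  \<open>W\<close>.\<close>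

lemma measurable_visits:
  fixes M :: "('s::finite, 'a::finite) mdp"
  assumes M: "mdp M" and rec: "recording M \<pi>\<^sub>b \<mu> K rec"
  shows "(\<lambda>D. visits rec D s a) \<in> data_measure M \<pi>\<^sub>b \<mu> K \<rightarrow>\<^sub>M count_space {U. finite U \<and> U \<subseteq> {..<K} \<times> UNIV}"
proof -
  let ?\<DD> = "data_measure M \<pi>\<^sub>b \<mu> K" and ?I = "{U :: (nat \<times> nat) set. finite U \<and> U \<subseteq> {..<K} \<times> UNIV}"
  have I: "countable ?I"
    by (rule countable_subset[OF _ countable_Collect_finite]) auto
  have m: "rec \<in> ?\<DD> \<rightarrow>\<^sub>M count_space ?I"
  proof (rule measurable_count_spaceI[OF I])
    have "rec \<in> space ?\<DD> \<rightarrow> {U. finite U}"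
      using rec by (auto simp: recording_def dest: measurable_space)
    then show "rec \<in> space ?\<DD> \<rightarrow> ?I"
      using rec by (fastforce simp: recording_def)
    show "rec -` {U} \<inter> space ?\<DD> \<in> sets ?\<DD>" if "U \<in> ?I" for U
      using rec that by (intro measurable_sets[of rec ?\<DD> "count_space {U. finite U}"]) (auto simp: recording_def)
  qed
  show ?thesis
    unfolding visits_def
  proof (rule measurable_compose_countable'[OF _ m I])
    fix W :: "(nat \<times> nat) set" assume W: "W \<in> ?I"
    have meas: "Measurable.pred ?\<DD> (\<lambda>D. fst (D k t) = s \<and> fst (snd (D k t)) = a)" if "k < K" for k t
    proof -
      note [measurable] = measurable_step(2,3) measurable_episode[OF M that]
      show ?thesis by measurable
    qed
    show "(\<lambda>D. {(k, t). (k, t) \<in> W \<and> fst (D k t) = s \<and> fst (snd (D k t)) = a}) \<in> ?\<DD> \<rightarrow>\<^sub>M count_space ?I"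
    proof (rule measurable_count_spaceI[OF I])
      show "(\<lambda>D. {(k, t). (k, t) \<in> W \<and> fst (D k t) = s \<and> fst (snd (D k t)) = a}) \<in> space ?\<DD> \<rightarrow> ?I"
        using W by (auto intro: finite_subset[of _ W])
      fix U
      \<comment> \<open>Equality of the visit set with \<open>U\<close> becomes countably many
        membership conditions.\<close>
      have "{D \<in> space ?\<DD>. \<forall>x. (x \<in> W \<and> fst (D (fst x) (snd x)) = s \<and> fst (snd (D (fst x) (snd x))) = a) = (x \<in> U)} \<in> sets ?\<DD>"
      proof (rule sets.sets_Collect_countable_All)
        fix x
        show "{D \<in> space ?\<DD>. (x \<in> W \<and> fst (D (fst x) (snd x)) = s \<and> fst (snd (D (fst x) (snd x))) = a) = (x \<in> U)} \<in> sets ?\<DD>"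
        proof (cases "x \<in> W")
          case True
          then have "fst x < K" using W by auto
          note [measurable] = meas[OF this, of "snd x"]
          show ?thesis by measurable
        qed auto
      qed
      also have "{D \<in> space ?\<DD>. \<forall>x. (x \<in> W \<and> fst (D (fst x) (snd x)) = s \<and> fst (snd (D (fst x) (snd x))) = a) = (x \<in> U)} =
        (\<lambda>D. {(k, t). (k, t) \<in> W \<and> fst (D k t) = s \<and> fst (snd (D k t)) = a}) -` {U} \<inter> space ?\<DD>"
        by (auto simp: set_eq_iff)
      finally show "(\<lambda>D. {(k, t). (k, t) \<in> W \<and> fst (D k t) = s \<and> fst (snd (D k t)) = a}) -` {U} \<inter> space ?\<DD> \<in> sets ?\<DD>" .
    qed
  qed
qed

lemma measurable_Q_hat_N_visits:
  fixes M :: "('s::finite, 'a::finite) mdp"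
  assumes M: "mdp M" and rec: "recording M \<pi>\<^sub>b \<mu> K rec"
  shows "(\<lambda>D. Q_hat M rec D s a) \<in> borel_measurable (data_measure M \<pi>\<^sub>b \<mu> K)"
    and "(\<lambda>D. N_visits rec D s a) \<in> data_measure M \<pi>\<^sub>b \<mu> K \<rightarrow>\<^sub>M count_space UNIV"
proof -
  let ?\<DD> = "data_measure M \<pi>\<^sub>b \<mu> K" and ?I = "{U :: (nat \<times> nat) set. finite U \<and> U \<subseteq> {..<K} \<times> UNIV}"
  have I: "countable ?I"
    by (rule countable_subset[OF _ countable_Collect_finite]) auto
  note v = measurable_visits[OF M rec, of s a]
  show "(\<lambda>D. N_visits rec D s a) \<in> ?\<DD> \<rightarrow>\<^sub>M count_space UNIV"
    unfolding N_visits_def by (rule measurable_compose_countable'[OF _ v I]) simp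
  have "(\<lambda>D. (\<Sum>(k, t)\<in>visits rec D s a. ret M t (D k)) / real (card (visits rec D s a))) \<in> borel_measurable ?\<DD>"
  proof (rule measurable_compose_countable'[OF _ v I])
    fix U :: "(nat \<times> nat) set" assume "U \<in> ?I"
    then have "(\<lambda>D. ret M t (D k)) \<in> borel_measurable ?\<DD>" if "(k, t) \<in> U" for k t
      using that by (intro measurable_compose[OF measurable_episode[OF M] ret_measurable]) auto
    then show "(\<lambda>D. (\<Sum>(k, t)\<in>U. ret M t (D k)) / real (card U)) \<in> borel_measurable ?\<DD>"
      by (intro borel_measurable_divide borel_measurable_sum) auto
  qed
  then show "(\<lambda>D. Q_hat M rec D s a) \<in> borel_measurable ?\<DD>"
    by (simp add: Q_hat_def N_visits_def)
qed

text \<open>For n variables in [-G, G] the squared widths add up to 4 n G^2. The sum may deviate by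
  e = n G sqrt (2 L / n), so 2 e^2 / (4 n G^2) = L; the leading factor 2 pays for both
  tails.\<close>

lemma Hoeffding_mean:
  fixes X :: "'i \<Rightarrow> 'b \<Rightarrow> real"
  assumes "prob_space C" and fin: "finite U" "U \<noteq> {}"
    and indep: "prob_space.indep_vars C (\<lambda>_. borel) X U"
    and bound: "\<And>i. i \<in> U \<Longrightarrow> AE x in C. \<bar>X i x\<bar> \<le> G"
    and mean: "\<And>i. i \<in> U \<Longrightarrow> (\<integral>x. X i x \<partial>C) = q" and L: "0 \<le> L"
  shows "measure C {x \<in> space C. \<bar>(\<Sum>i\<in>U. X i x) / card U - q\<bar> > G * sqrt (2 / card U * L)} \<le> 2 * exp (- L)"
proof -
  interpret prob_space C by fact
  have n: "real (card U) > 0" using fin by (simp add: card_gt_0_iff)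
  have rv: "X i \<in> borel_measurable C" if "i \<in> U" for i
    using indep that by (auto simp: indep_vars_def)
  have G: "0 \<le> G"
  proof -
    obtain i where "i \<in> U" using fin by auto
    from bound[OF this] have "AE x in C. 0 \<le> G" by eventually_elim linarith
    then show ?thesis by (simp add: AE_const)
  qed
  show ?thesis
  \<comment> \<open>The inequality applied below needs intervals of positive total squared width.
    For G = 0 all variables vanish almost surely, and so does the deviation.\<close>
  proof (cases "G = 0")
    case True
    have zero: "AE x in C. X i x = 0" if "i \<in> U" for i
      using bound[OF that] unfolding True abs_le_zero_iff .
    obtain i where i: "i \<in> U" using fin by auto
    have "q = (\<integral>x. 0 \<partial>C)"
      unfolding mean[OF i, symmetric] using zero[OF i] rv[OF i] by (intro integral_cong_AE) auto
    then have q: "q = 0" by simp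
    have "AE x in C. \<forall>i\<in>U. X i x = 0"
      using zero by (intro AE_finite_allI fin)
    then have "AE x in C. \<not> \<bar>(\<Sum>i\<in>U. X i x) / card U - q\<bar> > G * sqrt (2 / card U * L)"
      by eventually_elim (simp add: q True)
    then have "measure C {x \<in> space C. \<bar>(\<Sum>i\<in>U. X i x) / card U - q\<bar> > G * sqrt (2 / card U * L)} = 0"
      by (rule prob_eq_0_AE)
    then show ?thesis by simp
  next
    case False
    with G have G: "0 < G" by simp
    interpret Hoeffding_ineq C U X "\<lambda>_. - G" "\<lambda>_. G" "\<Sum>i\<in>U. expectation (X i)"
      by unfold_locales (use fin indep bound in \<open>auto simp: abs_le_iff minus_le_iff elim: eventually_mono\<close>)
    have mu: "(\<Sum>i\<in>U. expectation (X i)) = card U * q" using mean by simp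
    let ?e = "card U * (G * sqrt (2 / card U * L))"
    have e: "0 \<le> ?e" using G L by simp
    have pos: "(\<Sum>i\<in>U. (G - - G)\<^sup>2) > 0" using G n by simp
    have "measure C {x \<in> space C. \<bar>(\<Sum>i\<in>U. X i x) / card U - q\<bar> > G * sqrt (2 / card U * L)} \<le>
       measure C {x \<in> space C. \<bar>(\<Sum>i\<in>U. X i x) - (\<Sum>i\<in>U. expectation (X i))\<bar> \<ge> ?e}"
    proof (rule finite_measure_mono)
      have "?e \<le> \<bar>(\<Sum>i\<in>U. X i x) - card U * q\<bar>"
        if "G * sqrt (2 / card U * L) < \<bar>(\<Sum>i\<in>U. X i x) / card U - q\<bar>" for x
      proof -
        have "?e \<le> card U * \<bar>(\<Sum>i\<in>U. X i x) / card U - q\<bar>"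
          using that n by (intro mult_left_mono) auto
        also have "\<dots> = \<bar>card U * ((\<Sum>i\<in>U. X i x) / card U - q)\<bar>"
          using n by (simp add: abs_mult)
        also have "card U * ((\<Sum>i\<in>U. X i x) / card U - q) = (\<Sum>i\<in>U. X i x) - card U * q"
          using n by (simp add: right_diff_distrib)
        finally show ?thesis .
      qed
      then show "{x \<in> space C. \<bar>(\<Sum>i\<in>U. X i x) / card U - q\<bar> > G * sqrt (2 / card U * L)} \<subseteq>
          {x \<in> space C. \<bar>(\<Sum>i\<in>U. X i x) - (\<Sum>i\<in>U. expectation (X i))\<bar> \<ge> ?e}"
        unfolding mu by auto
      have "(\<lambda>x. \<Sum>i\<in>U. X i x) \<in> borel_measurable C"
        using rv by (intro borel_measurable_sum) auto
      then show "{x \<in> space C. \<bar>(\<Sum>i\<in>U. X i x) - (\<Sum>i\<in>U. expectation (X i))\<bar> \<ge> ?e} \<in> sets C"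
        by measurable
    qed
    also have "\<dots> \<le> 2 * exp (- 2 * ?e\<^sup>2 / (\<Sum>i\<in>U. (G - - G)\<^sup>2))"
      by (rule Hoeffding_ineq_abs_ge[OF e pos])
    also have "- 2 * ?e\<^sup>2 / (\<Sum>i\<in>U. (G - - G)\<^sup>2) = - L"
    proof -
      have "(sqrt (2 / card U * L))\<^sup>2 = 2 / card U * L" using L by (intro real_sqrt_pow2) simp
      then show ?thesis using G n
        by (simp add: power_mult_distrib power2_eq_square field_simps)
    qed
    finally show ?thesis .
  qed
qed

text \<open>Once the visit set is fixed, the random denominator and index set become constants and
  Hoeffding applies. Since its bound 2 exp (-L) is the same for every set, summing over the
  partition by visit sets returns it unchanged.\<close>

lemma Q_hat_concentration:
  fixes M :: "('s::finite, 'a::finite) mdp"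
  assumes M: "mdp M" and G: "return_bound M G" and rec: "recording M \<pi>\<^sub>b \<mu> K rec"
    and indep: "independent_returns M \<pi>\<^sub>b \<mu> K rec" and L: "0 \<le> L"
  shows "\<P>(D in data_measure M \<pi>\<^sub>b \<mu> K. N_visits rec D s a \<noteq> 0 \<and>
    \<bar>Q_hat M rec D s a - Q M \<pi>\<^sub>b s a\<bar> > G * sqrt (2 / N_visits rec D s a * L)) \<le> 2 * exp (- L)"
proof -
  let ?\<DD> = "data_measure M \<pi>\<^sub>b \<mu> K" and ?I = "{U :: (nat \<times> nat) set. finite U \<and> U \<subseteq> {..<K} \<times> UNIV}"
  interpret prob_space ?\<DD> by (rule prob_space_data[OF M])
  have I: "countable ?I"
    by (rule countable_subset[OF _ countable_Collect_finite]) auto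
  note v = measurable_visits[OF M rec, of s a]
  note [measurable] = measurable_Q_hat_N_visits[OF M rec]
  define E where "E U = {D \<in> space ?\<DD>. visits rec D s a = U}" for U
  define B where "B = {D \<in> space ?\<DD>. N_visits rec D s a \<noteq> 0 \<and>
    \<bar>Q_hat M rec D s a - Q M \<pi>\<^sub>b s a\<bar> > G * sqrt (2 / N_visits rec D s a * L)}"
  have B: "B \<in> sets ?\<DD>" unfolding B_def by measurable
  have E: "E U \<in> sets ?\<DD>" if "U \<in> ?I" for U
    using measurable_sets[OF v, of "{U}"] that
    by (simp add: E_def vimage_def Int_def conj_commute)
  \<comment> \<open>The multiplied form makes sense even on null sets. Empty and null visit sets are
    split off: the former are disjoint from \<open>B\<close>, and on the latter conditioning gives
    no probability measure.\<close>
  have bound: "emeasure ?\<DD> (B \<inter> E U) \<le> ennreal (2 * exp (- L)) * emeasure ?\<DD> (E U)" if U: "U \<in> ?I" for U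
  proof (cases "U = {} \<or> emeasure ?\<DD> (E U) = 0")
    case True
    then show ?thesis
    proof
      assume "U = {}"
      then have "B \<inter> E U = {}" by (auto simp: B_def E_def N_visits_def)
      then show ?thesis by simp
    next
      assume "emeasure ?\<DD> (E U) = 0"
      moreover have "emeasure ?\<DD> (B \<inter> E U) \<le> emeasure ?\<DD> (E U)"
        by (rule emeasure_mono[OF _ E[OF U]]) auto
      ultimately show ?thesis by simp
    qed
  next
    case False
    define C where "C = uniform_measure ?\<DD> (E U)"
    have C: "prob_space C" "sets C = sets ?\<DD>" "space C = space ?\<DD>"
      using False by (auto simp: C_def intro!: prob_space_uniform_measure)
    interpret C: prob_space C by (rule C)
    have pos: "measure ?\<DD> (E U) > 0"
      using False by (simp add: emeasure_eq_measure zero_less_measure_iff)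
    have ind: "prob_space.indep_vars C (\<lambda>_. borel) (\<lambda>(k, t) D. ret M t (D k)) U"
      and mean: "\<And>k t. (k, t) \<in> U \<Longrightarrow> (\<integral>D. ret M t (D k) \<partial>C) = Q M \<pi>\<^sub>b s a"
      using indep[unfolded independent_returns_def, rule_format, of s a U] pos
      by (auto simp: C_def E_def Let_def)
    have AE: "AE D in C. \<bar>ret M t (D k)\<bar> \<le> G" if kt: "(k, t) \<in> U" for k t
      unfolding C_def
    proof (rule AE_uniform_measureI[OF E[OF U]])
      show "AE D in ?\<DD>. D \<in> E U \<longrightarrow> \<bar>ret M t (D k)\<bar> \<le> G"
        using AE_data_ret_bounded[OF M G, where \<pi>\<^sub>b=\<pi>\<^sub>b and \<mu>=\<mu> and K=K]
      proof eventually_elim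
        case (elim D)
        show ?case
        proof
          assume D: "D \<in> E U"
          then have "(k, t) \<in> rec D" using kt by (auto simp: E_def visits_def)
          moreover have "D \<in> space ?\<DD>" using D by (simp add: E_def)
          ultimately have "k < K \<and> enat t \<le> termination_time M (D k)"
            using rec by (auto simp: recording_def)
          with elim show "\<bar>ret M t (D k)\<bar> \<le> G" by auto
        qed
      qed
    qed
    let ?B' = "{D \<in> space C. \<bar>(\<Sum>i\<in>U. (case i of (k, t) \<Rightarrow> \<lambda>D. ret M t (D k)) D) / card U - Q M \<pi>\<^sub>b s a\<bar>
        > G * sqrt (2 / card U * L)}"
    have le: "measure C ?B' \<le> 2 * exp (- L)"
      by (rule Hoeffding_mean[OF C(1) _ _ ind _ _ L]) (use U False AE mean in auto)
    \<comment> \<open>On \<open>E U\<close> the event \<open>B\<close> is a deviation event for the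
      fixed index set \<open>U\<close>.\<close>
    have eq: "B \<inter> E U = E U \<inter> ?B'"
      using U False by (auto simp: B_def E_def C(3) Q_hat_def N_visits_def case_prod_unfold card_gt_0_iff)
    have "(\<lambda>D. \<Sum>i\<in>U. (case i of (k, t) \<Rightarrow> \<lambda>D. ret M t (D k)) D) \<in> borel_measurable C"
      using ind by (intro borel_measurable_sum) (auto simp: C.indep_vars_def)
    then have "?B' \<in> sets C" by measurable
    then have B': "?B' \<in> sets ?\<DD>" by (simp only: C(2))
    have "emeasure ?\<DD> (E U \<inter> ?B') / emeasure ?\<DD> (E U) = emeasure C ?B'"
      using emeasure_uniform_measure[OF E[OF U] B'] by (simp add: C_def)
    also have "\<dots> \<le> ennreal (2 * exp (- L))"
      using le by (simp add: C.emeasure_eq_measure ennreal_leI)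
    finally have "emeasure ?\<DD> (E U \<inter> ?B') / emeasure ?\<DD> (E U) * emeasure ?\<DD> (E U) \<le> ennreal (2 * exp (- L)) * emeasure ?\<DD> (E U)"
      by (rule mult_right_mono) simp
    moreover have "emeasure ?\<DD> (E U \<inter> ?B') / emeasure ?\<DD> (E U) * emeasure ?\<DD> (E U) = emeasure ?\<DD> (E U \<inter> ?B')"
      using False emeasure_finite[of "E U"]
      by (simp add: ennreal_divide_times ennreal_divide_self less_top[symmetric])
    ultimately show ?thesis by (simp add: eq)
  qed
  have cover: "(\<Union>U\<in>?I. E U) = space ?\<DD>"
  proof (rule antisym)
    show "space ?\<DD> \<subseteq> (\<Union>U\<in>?I. E U)"
    proof
      fix D assume "D \<in> space ?\<DD>"
      with measurable_space[OF v this] show "D \<in> (\<Union>U\<in>?I. E U)"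
        unfolding space_count_space by (intro UN_I[of "visits rec D s a"]) (simp_all add: E_def)
    qed
  qed (simp add: E_def UN_subset_iff)
  have disj: "disjoint_family_on E ?I"
    unfolding disjoint_family_on_def E_def by blast
  have "emeasure ?\<DD> B = emeasure ?\<DD> (\<Union>U\<in>?I. B \<inter> E U)"
    using cover sets.sets_into_space[OF B] by (intro arg_cong[where f="emeasure ?\<DD>"]) auto
  also have "\<dots> = (\<integral>\<^sup>+U. emeasure ?\<DD> (B \<inter> E U) \<partial>count_space ?I)"
    using I B E disj by (intro emeasure_UN_countable) (auto simp: disjoint_family_on_def)
  also have "\<dots> \<le> (\<integral>\<^sup>+U. ennreal (2 * exp (- L)) * emeasure ?\<DD> (E U) \<partial>count_space ?I)"
    by (intro nn_integral_mono bound) simp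
  also have "\<dots> = ennreal (2 * exp (- L)) * (\<integral>\<^sup>+U. emeasure ?\<DD> (E U) \<partial>count_space ?I)"
    by (intro nn_integral_cmult) simp
  also have "(\<integral>\<^sup>+U. emeasure ?\<DD> (E U) \<partial>count_space ?I) = emeasure ?\<DD> (\<Union>U\<in>?I. E U)"
    using I E disj by (intro emeasure_UN_countable[symmetric]) auto
  also have "\<dots> = 1" unfolding cover by (rule emeasure_space_1)
  finally have "prob B \<le> 2 * exp (- L)" by (simp add: emeasure_eq_measure)
  then show ?thesis unfolding B_def .
qed

section \<open>From the constraint to the value bound\<close>

lemma constrained_real_sum:
  fixes \<pi> \<pi>\<^sub>b :: "('s, 'a::finite) policy"
  assumes con: "constrained \<pi>\<^sub>b \<epsilon> e \<pi>" and e: "\<And>a. 0 \<le> e s a"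
    and inf: "\<And>a. e s a \<noteq> \<infinity> \<Longrightarrow> e s a = ereal (e' a)"
  shows "(\<Sum>a\<in>UNIV. (if e s a = \<infinity> then 0 else e' a * \<bar>pmf (\<pi> s) a - pmf (\<pi>\<^sub>b s) a\<bar>)) \<le> \<epsilon>"
    and "e s a = \<infinity> \<Longrightarrow> pmf (\<pi> s) a = pmf (\<pi>\<^sub>b s) a"
proof -
  let ?d = "\<lambda>a. \<bar>pmf (\<pi> s) a - pmf (\<pi>\<^sub>b s) a\<bar>"
  have le: "(\<Sum>a\<in>UNIV. e s a * ereal (?d a)) \<le> ereal \<epsilon>"
    using con by (simp add: constrained_def)
  \<comment> \<open>All summands are nonnegative, so a single infinite one would already exceed
    \<open>\<epsilon>\<close>.\<close>
  have eq: "pmf (\<pi> s) a = pmf (\<pi>\<^sub>b s) a" if "e s a = \<infinity>" for a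
  proof (rule ccontr)
    assume "pmf (\<pi> s) a \<noteq> pmf (\<pi>\<^sub>b s) a"
    then have "e s a * ereal (?d a) = \<infinity>" using that by simp
    moreover have "e s a * ereal (?d a) \<le> (\<Sum>a\<in>UNIV. e s a * ereal (?d a))"
      using sum_mono2[of UNIV "{a}" "\<lambda>a. e s a * ereal (?d a)"] e by simp
    ultimately show False using le by auto
  qed
  then show "e s a = \<infinity> \<Longrightarrow> pmf (\<pi> s) a = pmf (\<pi>\<^sub>b s) a" .
  have "e s a * ereal (?d a) = ereal (if e s a = \<infinity> then 0 else e' a * ?d a)" for a
    using eq[of a] inf[of a] by auto
  then have "(\<Sum>a\<in>UNIV. e s a * ereal (?d a)) = ereal (\<Sum>a\<in>UNIV. if e s a = \<infinity> then 0 else e' a * ?d a)"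
    by (simp add: sum_ereal)
  with le show "(\<Sum>a\<in>UNIV. (if e s a = \<infinity> then 0 else e' a * ?d a)) \<le> \<epsilon>" by simp
qed

theorem theorem3:
  fixes M :: "('s::finite, 'a::finite) mdp"
    and \<pi>\<^sub>b :: "('s, 'a) policy"
    and \<pi> :: "('s, 'a) data \<Rightarrow> ('s, 'a) policy"
    and rec :: "('s, 'a) data \<Rightarrow> (nat \<times> nat) set"
    and \<mu> :: "'s pmf" and K :: nat and \<epsilon> \<delta> Gmax :: real
  defines "\<DD> \<equiv> data_measure M \<pi>\<^sub>b \<mu> K"
  assumes "mdp M"
    and "return_bound M Gmax"
    and "recording M \<pi>\<^sub>b \<mu> K rec"
    and "independent_returns M \<pi>\<^sub>b \<mu> K rec"
    and "\<epsilon> > 0" and "\<delta> > 0"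
    and "\<And>s a. (\<lambda>D. pmf (\<pi> D s) a) \<in> borel_measurable \<DD>"
    and "\<And>D. D \<in> space \<DD> \<Longrightarrow> constrained \<pi>\<^sub>b \<epsilon> (e_Q rec \<delta> D) (\<pi> D)"
    and "\<And>D. D \<in> space \<DD> \<Longrightarrow> advantageous \<pi>\<^sub>b (Q_hat M rec D) (\<pi> D)"
  shows "\<P>(D in \<DD>. \<forall>s. V M (\<pi> D) s - V M \<pi>\<^sub>b s \<ge> - (\<epsilon> * Gmax / (1 - discount M)))
           \<ge> 1 - \<delta>"
proof (cases "\<delta> < 1")
  case False
  then have "1 - \<delta> \<le> 0" by simp
  also have "0 \<le> \<P>(D in \<DD>. \<forall>s. V M (\<pi> D) s - V M \<pi>\<^sub>b s \<ge> - (\<epsilon> * Gmax / (1 - discount M)))"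
    by (rule measure_nonneg)
  finally show ?thesis .
next
  \<comment> \<open>For \<open>\<delta> \<ge> 1\<close> the claimed lower bound is not positive.
    Otherwise the argument of the logarithm in \<open>e_Q\<close> is at least 1, which makes
    \<open>L\<close> nonnegative.\<close>
  case True
  note M = assms(2) and G = assms(3) and rec = assms(4) and indep = assms(5)
  interpret prob_space \<DD> unfolding \<DD>_def by (rule prob_space_data[OF M])
  note [measurable] = measurable_Q_hat_N_visits[OF M rec, folded \<DD>_def] measurable_V[OF M assms(8)]
  let ?c = "real CARD('s) * real CARD('a)"
  define L where "L = ln (2 * real CARD('s) * real CARD('a) / \<delta>)"
  have c: "1 \<le> ?c"
    using mult_mono[of 1 "real CARD('s)" 1 "real CARD('a)"] by (simp add: Suc_le_eq)
  then have "1 \<le> 2 * ?c / \<delta>" using True \<open>\<delta> > 0\<close> by (simp add: pos_le_divide_eq)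
  \<comment> \<open>In the logarithm, the 2 cancels the factor of the two-sided bound and the number
    of pairs cancels the size of the union bound.\<close>
  then have L: "0 \<le> L" and exp_L: "exp (- L) = \<delta> / (2 * ?c)"
    by (auto simp: L_def exp_minus mult.assoc)
  define bad where "bad s a = {D \<in> space \<DD>. N_visits rec D s a \<noteq> 0 \<and>
    \<bar>Q_hat M rec D s a - Q M \<pi>\<^sub>b s a\<bar> > Gmax * sqrt (2 / N_visits rec D s a * L)}" for s a
  have bad: "bad s a \<in> events" for s a
    unfolding bad_def by measurable
  have "prob (\<Union>(s, a)\<in>UNIV. bad s a) \<le> (\<Sum>(s, a)\<in>UNIV. prob (bad s a))"
    using finite_measure_subadditive_finite[of UNIV "\<lambda>(s, a). bad s a"] bad
    by (auto simp: case_prod_unfold)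
  also have "\<dots> \<le> (\<Sum>(s :: 's, a :: 'a)\<in>UNIV. 2 * exp (- L))"
    using Q_hat_concentration[OF M G rec indep L, folded \<DD>_def]
    by (intro sum_mono) (auto simp: bad_def)
  also have "\<dots> = \<delta>"
    using c by (simp add: exp_L case_prod_unfold UNIV_Times_UNIV[symmetric] card_cartesian_product del: UNIV_Times_UNIV)
  finally have union: "prob (\<Union>(s, a)\<in>UNIV. bad s a) \<le> \<delta>" .
  \<comment> \<open>Deterministic from here on: \<open>bad\<close> does not mention
    \<open>\<pi>\<close>, so the dependence of \<open>\<pi>\<close> on \<open>D\<close> does no
    harm.\<close>
  have good: "- (\<epsilon> * Gmax / (1 - discount M)) \<le> V M (\<pi> D) s - V M \<pi>\<^sub>b s"
    if D: "D \<in> space \<DD>" and nb: "\<And>s a. D \<notin> bad s a" for D s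
  proof (rule V_diff_ge[OF M])
    note Gpos = return_bound_nonneg[OF M G]
    show "0 \<le> \<epsilon> * Gmax" using Gpos \<open>\<epsilon> > 0\<close> by simp
    fix s
    let ?e = "\<lambda>a. sqrt (2 / N_visits rec D s a * L)"
    let ?d = "\<lambda>a. pmf (\<pi> D s) a - pmf (\<pi>\<^sub>b s) a"
    have e0: "0 \<le> e_Q rec \<delta> D s a" for a
      using L by (simp add: e_Q_def L_def[symmetric])
    have einf: "e_Q rec \<delta> D s a = \<infinity> \<longleftrightarrow> N_visits rec D s a = 0" for a
      by (simp add: e_Q_def)
    have ereal: "e_Q rec \<delta> D s a \<noteq> \<infinity> \<Longrightarrow> e_Q rec \<delta> D s a = ereal (?e a)" for a
      by (cases "N_visits rec D s a = 0") (simp_all add: e_Q_def L_def)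
    note con = constrained_real_sum[OF assms(9)[OF D] e0 ereal, unfolded einf]
    \<comment> \<open>At an unvisited pair both sides are 0, because the infinite error forces the
      policies to agree there; this is why \<open>bad\<close> only has to control visited
      pairs.\<close>
    have "- (Gmax * (if N_visits rec D s a = 0 then 0 else ?e a * \<bar>?d a\<bar>)) \<le>
        (Q M \<pi>\<^sub>b s a - Q_hat M rec D s a) * ?d a" for a
    proof (cases "N_visits rec D s a = 0")
      case False
      with nb[of s a] D have "\<bar>Q M \<pi>\<^sub>b s a - Q_hat M rec D s a\<bar> \<le> Gmax * ?e a"
        by (simp add: bad_def abs_minus_commute)
      then have "\<bar>(Q M \<pi>\<^sub>b s a - Q_hat M rec D s a) * ?d a\<bar> \<le> Gmax * ?e a * \<bar>?d a\<bar>"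
        unfolding abs_mult by (rule mult_right_mono) simp
      with False show ?thesis by (simp add: mult.assoc abs_le_iff)
    qed (simp add: con(2))
    then have "(\<Sum>a\<in>UNIV. - (Gmax * (if N_visits rec D s a = 0 then 0 else ?e a * \<bar>?d a\<bar>))) \<le>
        (\<Sum>a\<in>UNIV. (Q M \<pi>\<^sub>b s a - Q_hat M rec D s a) * ?d a)"
      by (rule sum_mono)
    moreover have "Gmax * (\<Sum>a\<in>UNIV. if N_visits rec D s a = 0 then 0 else ?e a * \<bar>?d a\<bar>) \<le> Gmax * \<epsilon>"
      by (rule mult_left_mono[OF con(1) Gpos])
    moreover have "0 \<le> (\<Sum>a\<in>UNIV. Q_hat M rec D s a * ?d a)"
      using assms(10)[OF D] by (simp add: advantageous_def right_diff_distrib sum_subtractf)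
    moreover have "(\<Sum>a\<in>UNIV. Q M \<pi>\<^sub>b s a * ?d a) =
        (\<Sum>a\<in>UNIV. (Q M \<pi>\<^sub>b s a - Q_hat M rec D s a) * ?d a) + (\<Sum>a\<in>UNIV. Q_hat M rec D s a * ?d a)"
      by (simp add: sum.distrib[symmetric] distrib_right[symmetric])
    ultimately show "- (\<epsilon> * Gmax) \<le> (\<Sum>a\<in>UNIV. Q M \<pi>\<^sub>b s a * ?d a)"
      by (simp add: sum_negf sum_distrib_left mult.commute)
  qed
  have "1 - \<delta> \<le> 1 - prob (\<Union>(s, a)\<in>UNIV. bad s a)" using union by simp
  also have "\<dots> = prob (space \<DD> - (\<Union>(s, a)\<in>UNIV. bad s a))"
    using bad by (intro prob_compl[symmetric] sets.finite_UN) auto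
  also have "\<dots> \<le> \<P>(D in \<DD>. \<forall>s. V M (\<pi> D) s - V M \<pi>\<^sub>b s \<ge> - (\<epsilon> * Gmax / (1 - discount M)))"
  proof (rule finite_measure_mono)
    show "space \<DD> - (\<Union>(s, a)\<in>UNIV. bad s a) \<subseteq>
        {D \<in> space \<DD>. \<forall>s. V M (\<pi> D) s - V M \<pi>\<^sub>b s \<ge> - (\<epsilon> * Gmax / (1 - discount M))}"
      using good by blast
    \<comment> \<open>Monotonicity of \<open>measure\<close> requires the larger set to be an event;
      the measurability of \<open>V M (\<pi> D) s\<close> in \<open>D\<close> provides this.\<close>
    show "{D \<in> space \<DD>. \<forall>s. V M (\<pi> D) s - V M \<pi>\<^sub>b s \<ge> - (\<epsilon> * Gmax / (1 - discount M))} \<in> events"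
      by measurable
  qed
  finally show ?thesis .
qed

end
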